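(* Let $\lambda=(\lambda_1,\dots,\lambda_\ell)$ be a partition (with $\lambda_{\ell+1}=0$), and let $\mathcal{B}(\lambda)$ be the set of all plane overpartitions $\Pi$ (of any shape, the empty one included) such that for every $i\ge1$ the $i$-th row of $\Pi$ has at most $\lambda_i$ entries and at least $\lambda_{i+1}$ entries (where $\lambda_i=0$ for $i>\ell$). Then $$\sum_{\Pi \in \mathcal{B}(\lambda)} a^{o(\Pi)}q^{|\Pi|}=q^{\sum_i (i-1)\lambda_i}\prod_{(i,j)\in\lambda}\frac{1+aq^{c_{i,j}+1}}{1-q^{h_{i,j}}}.$$
   Context: A partition $\lambda$ is identified with its Ferrers diagram, the set of cells $(i,j)$ with $1\le j\le\lambda_i$; $\lambda'$ is the conjugate partition; hook length $h_{i,j}=\lambda_i+\lambda'_j-i-j+1$ and content $c_{i,j}=j-i$. A plane overpartition of shape $\mu$ is a filling of the cells of the Ferrers diagram of a partition $\mu$ with positive integers, weakly decreasing along each row (left to right) and each column (top to bottom), in which some entries are overlined subject to: (1) in each row, only the last (rightmost) occurrence of a given integer may be overlined; (2) in each column, the first (topmost) occurrence of a given integer may be overlined or not, and all other occurrences of that integer in the column are overlined. $|\Pi|$ is the sum of all entries (ignoring overlines), $o(\Pi)$ the number of overlined entries. *)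

theory Defs
  imports
    "HOL-Analysis.Infinite_Sum"
    "HOL-Computational_Algebra.Formal_Laurent_Series"
begin

definition is_partition :: "nat list \<Rightarrow> bool" where
  "is_partition lam \<longleftrightarrow> sorted_wrt (\<ge>) lam \<and> (\<forall>x\<in>set lam. 0 < x)"

(* Parts are indexed from 1, and the parts beyond the last one are 0. *)
definition part :: "nat list \<Rightarrow> nat \<Rightarrow> nat" where
  "part lam i = (if 1 \<le> i \<and> i \<le> length lam then lam ! (i - 1) else 0)"

definition diagram :: "nat list \<Rightarrow> (nat \<times> nat) set" where
  "diagram lam = {(i, j). 1 \<le> i \<and> 1 \<le> j \<and> j \<le> part lam i}"

definition conjugate :: "nat list \<Rightarrow> nat list" where
  "conjugate lam = map (\<lambda>j. card {i. (i, j) \<in> diagram lam}) [1..<Suc (part lam 1)]"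

definition hook_length :: "nat list \<Rightarrow> nat \<Rightarrow> nat \<Rightarrow> int" where
  "hook_length lam i j =
     int (part lam i) + int (part (conjugate lam) j) - int i - int j + 1"

definition cell_content :: "nat \<Rightarrow> nat \<Rightarrow> int" where
  "cell_content i j = int j - int i"

(* A filling is a partial map on cells (row, column), whose value at a cell is the integer there
   together with a flag telling whether it is overlined. Its domain is the shape, so that distinct
   maps are distinct fillings. *)
type_synonym filling = "nat \<times> nat \<rightharpoonup> nat \<times> bool"

definition entry :: "filling \<Rightarrow> nat \<Rightarrow> nat \<Rightarrow> nat" where
  "entry P i j = fst (the (P (i, j)))"

definition overlined :: "filling \<Rightarrow> nat \<Rightarrow> nat \<Rightarrow> bool" where
  "overlined P i j \<longleftrightarrow> snd (the (P (i, j)))"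

definition plane_overpartition :: "nat list \<Rightarrow> filling \<Rightarrow> bool" where
  "plane_overpartition mu P \<longleftrightarrow>
     is_partition mu \<and> dom P = diagram mu \<and>
     (\<forall>(i, j)\<in>dom P. 0 < entry P i j) \<and>
     (\<forall>i j k. (i, j) \<in> dom P \<and> (i, k) \<in> dom P \<and> j < k \<longrightarrow> entry P i k \<le> entry P i j) \<and>
     (\<forall>i j k. (i, j) \<in> dom P \<and> (k, j) \<in> dom P \<and> i < k \<longrightarrow> entry P k j \<le> entry P i j) \<and>
     (\<forall>i j k. (i, j) \<in> dom P \<and> (i, k) \<in> dom P \<and> j < k \<and> entry P i j = entry P i k
        \<longrightarrow> \<not> overlined P i j) \<and>
     (\<forall>i j k. (i, j) \<in> dom P \<and> (k, j) \<in> dom P \<and> i < k \<and> entry P i j = entry P k j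
        \<longrightarrow> overlined P k j)"

definition weight :: "filling \<Rightarrow> nat" where
  "weight P = (\<Sum>(i, j)\<in>dom P. entry P i j)"

definition num_overlined :: "filling \<Rightarrow> nat" where
  "num_overlined P = card {(i, j). (i, j) \<in> dom P \<and> overlined P i j}"

(* The number of entries in row i of a filling of shape mu is part mu i. *)
definition overpartitions_between :: "nat list \<Rightarrow> filling set" where
  "overpartitions_between lam =
     {P. \<exists>mu. plane_overpartition mu P \<and>
           (\<forall>i\<ge>1. part lam (i + 1) \<le> part mu i \<and> part mu i \<le> part lam i)}"

end

theory Submission
  imports Defs "Jordan_Normal_Form.Determinant"
begin

text \<open>
  Coding an entry \<open>n\<close> as \<open>2 * n\<close>, or as \<open>2 * n - 1\<close> if it is overlined, and filling the empty
  cells of \<open>\<lambda>\<close> with \<open>0\<close> turns \<open>\<B>(\<lambda>)\<close> into the set of all super tableaux of shape \<open>\<lambda>\<close>: even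
  values form horizontal strips and odd values vertical strips. Peeling off the values \<open>0\<close> and
  \<open>1\<close> gives the recurrence
  \<open>F \<lambda> = (\<Sum>\<mu>. q ^ \<bar>\<mu>\<bar> * (\<Sum>\<nu>. a ^ (\<bar>\<mu>\<bar> - \<bar>\<nu>\<bar>) * F \<nu>))\<close>, with \<open>\<lambda> / \<mu>\<close> a horizontal and
  \<open>\<mu> / \<nu>\<close> a vertical strip. Its only solution with \<open>F \<emptyset> = 1\<close> is the generating function, as
  every nonempty \<open>\<mu>\<close> contributes a factor \<open>q\<close>.

  The determinant of the \<open>h (\<lambda>\<^sub>i - i + j)\<close>, where \<open>h n\<close> is the product of
  \<open>(1 + a * q ^ k) / (1 - q ^ k)\<close> over \<open>k = 1, \<dots>, n\<close>, solves the same recurrence by multilinearity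
  in the rows, because \<open>h n - h (n - 1) = q ^ n * (h n + a * h (n - 1))\<close>. It evaluates to the hook
  product: its entries are polynomials of degree below \<open>l\<close> in \<open>q ^ (\<lambda>\<^sub>i + l - i)\<close> up to a factor per
  row, so it is a constant multiple of a Vandermonde determinant, and the constant is found by
  taking \<open>\<lambda> = \<emptyset>\<close>.
\<close>

section \<open>Determinants\<close>

lemma det_mat_permutes:
  "det (mat n n (\<lambda>(i, j). M i j)) =
     (\<Sum>p | p permutes {0..<n}. signof p * (\<Prod>i = 0..<n. M i (p i) :: 'a :: comm_ring_1))"
proof -
  have "det (mat n n (\<lambda>(i, j). M i j)) =
      (\<Sum>p | p permutes {0..<n}.
        signof p * (\<Prod>i = 0..<n. mat n n (\<lambda>(i, j). M i j) $$ (i, p i)))"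
    by (rule det_def') simp
  also have "\<dots> = (\<Sum>p | p permutes {0..<n}. signof p * (\<Prod>i = 0..<n. M i (p i)))"
    by (intro sum.cong refl arg_cong2[where f = "(*)"] prod.cong)
       (auto dest: permutes_in_image)
  finally show ?thesis .
qed

text \<open>Every permutation meets each row and each column exactly once, so all Leibniz terms pick
  up the same factor.\<close>

lemma det_scale_rows_columns:
  fixes M :: "nat \<Rightarrow> nat \<Rightarrow> 'a :: comm_ring_1"
  shows "det (mat n n (\<lambda>(i, j). u i * v j * M i j)) =
    (\<Prod>i = 0..<n. u i) * (\<Prod>j = 0..<n. v j) * det (mat n n (\<lambda>(i, j). M i j))"
proof -
  have "(\<Prod>i = 0..<n. u i * v (p i) * M i (p i)) =
      (\<Prod>i = 0..<n. u i) * (\<Prod>j = 0..<n. v j) * (\<Prod>i = 0..<n. M i (p i))"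
    if "p permutes {0..<n}" for p
    using prod.permute[OF that, of v] by (simp add: prod.distrib o_def)
  then show ?thesis
    unfolding det_mat_permutes sum_distrib_left
    by (intro sum.cong refl) (simp add: algebra_simps)
qed

text \<open>Multilinearity in the rows: the product in each Leibniz term is expanded over choice
  functions and the two sums are swapped. Later the choice functions encode strips, row by
  row.\<close>

lemma det_row_sums:
  fixes G :: "nat \<Rightarrow> 'b \<Rightarrow> nat \<Rightarrow> 'a :: comm_ring_1"
  assumes "\<And>i. i < n \<Longrightarrow> finite (S i)"
  shows "det (mat n n (\<lambda>(i, j). \<Sum>s\<in>S i. G i s j)) =
    (\<Sum>f\<in>PiE {0..<n} S. det (mat n n (\<lambda>(i, j). G i (f i) j)))"
proof -
  have "det (mat n n (\<lambda>(i, j). \<Sum>s\<in>S i. G i s j)) =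
      (\<Sum>p | p permutes {0..<n}. \<Sum>f\<in>PiE {0..<n} S. signof p * (\<Prod>i = 0..<n. G i (f i) (p i)))"
    unfolding det_mat_permutes sum_distrib_left[symmetric]
    using assms by (intro sum.cong refl arg_cong2[where f = "(*)"] prod_sum_PiE) auto
  then show ?thesis
    unfolding det_mat_permutes by (subst (asm) sum.swap)
qed

lemma det_unit_upper_triangular:
  fixes M :: "nat \<Rightarrow> nat \<Rightarrow> 'a :: comm_ring_1"
  assumes "\<And>i j. j < i \<Longrightarrow> i < n \<Longrightarrow> M i j = 0" and "\<And>i. i < n \<Longrightarrow> M i i = 1"
  shows "det (mat n n (\<lambda>(i, j). M i j)) = 1"
proof -
  let ?M = "mat n n (\<lambda>(i, j). M i j)"
  have "upper_triangular ?M" "?M \<in> carrier_mat n n"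
    using assms(1) by (auto simp: upper_triangular_def)
  then have "det ?M = prod_list (diag_mat ?M)" by (rule det_upper_triangular)
  also have "diag_mat ?M = map (\<lambda>_. 1) [0..<n]"
    unfolding diag_mat_def using assms(2) by (auto intro!: map_cong)
  also have "prod_list \<dots> = 1" by (induction n) auto
  finally show ?thesis .
qed

text \<open>Left multiplication by a unit upper bidiagonal matrix. The vanishing extra row
  \<open>n\<close> lets the unchanged last row obey the same formula.\<close>

lemma det_row_differences:
  fixes M :: "nat \<Rightarrow> nat \<Rightarrow> 'a :: comm_ring_1"
  assumes "\<And>j. j < n \<Longrightarrow> M n j = 0"
  shows "det (mat n n (\<lambda>(i, j). M i j - M (Suc i) j)) = det (mat n n (\<lambda>(i, j). M i j))"
proof -
  define U :: "'a mat"
    where "U = mat n n (\<lambda>(i, k). if k = i then 1 else if k = Suc i then - 1 else 0)"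
  have "(\<Sum>k = 0..<n. (if k = i then 1 else if k = Suc i then - 1 else 0) * M k j) =
      M i j - M (Suc i) j" if "i < n" "j < n" for i j
  proof -
    have "(\<Sum>k = 0..<n. (if k = i then 1 else if k = Suc i then - 1 else 0) * M k j) =
        (\<Sum>k = 0..<n. (if k = i then M k j else 0) - (if k = Suc i then M k j else 0))"
      by (intro sum.cong) auto
    also have "\<dots> = M i j - M (Suc i) j"
      using that assms[of j] by (cases "Suc i = n") (auto simp: sum_subtractf)
    finally show ?thesis .
  qed
  then have "U * mat n n (\<lambda>(i, j). M i j) = mat n n (\<lambda>(i, j). M i j - M (Suc i) j)"
    unfolding U_def by (intro eq_matI) (auto simp: scalar_prod_def)
  moreover have "det U = 1"
    unfolding U_def by (rule det_unit_upper_triangular) auto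
  ultimately show ?thesis
    using det_mult[of U n "mat n n (\<lambda>(i, j). M i j)"] by (simp add: U_def)
qed

text \<open>Subtracting \<open>x 0\<close> times the preceding column from each column turns the
  first row into 1, 0, ..., 0. Expanding along it leaves a smaller Vandermonde matrix with the
  factor \<open>x i - x 0\<close> in each remaining row.\<close>

lemma det_vandermonde:
  fixes x :: "nat \<Rightarrow> 'a :: comm_ring_1"
  shows "det (mat n n (\<lambda>(i, j). x i ^ j)) = (\<Prod>j<n. \<Prod>i<j. x j - x i)"
proof (induction n arbitrary: x)
  case 0
  then show ?case by simp
next
  case (Suc n)
  define U :: "'a mat"
    where "U = mat (Suc n) (Suc n) (\<lambda>(k, j). if k = j then 1 else if Suc k = j then - x 0 else 0)"
  define V where "V = mat (Suc n) (Suc n) (\<lambda>(i, j). x i ^ j)"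
  define W where "W = mat (Suc n) (Suc n) (\<lambda>(i, j). if j = 0 then 1 else x i ^ (j - 1) * (x i - x 0))"
  have "(\<Sum>k = 0..<Suc n. x i ^ k * (if k = j then 1 else if Suc k = j then - x 0 else 0)) =
      (if j = 0 then 1 else x i ^ (j - 1) * (x i - x 0))" if "j < Suc n" for i j
  proof -
    have "(\<Sum>k = 0..<Suc n. x i ^ k * (if k = j then 1 else if Suc k = j then - x 0 else 0)) =
        (\<Sum>k = 0..<Suc n. (if k = j then x i ^ k else 0) +
           (if Suc k = j then x i ^ k * (- x 0) else 0))"
      by (intro sum.cong) auto
    also have "\<dots> = x i ^ j + (\<Sum>k = 0..<Suc n. if Suc k = j then x i ^ k * (- x 0) else 0)"
      using that by (simp add: sum.distrib del: sum.op_ivl_Suc)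
    \<comment> \<open>The condition is brought into the form \<open>k = j - 1\<close>, which picks
      out one index. For \<open>j = 0\<close> truncated subtraction would pick out 0, so the summand
      itself has to vanish there.\<close>
    also have "(\<Sum>k = 0..<Suc n. if Suc k = j then x i ^ k * (- x 0) else 0) =
        (\<Sum>k = 0..<Suc n. if k = j - 1 then (if j = 0 then 0 else x i ^ k * (- x 0)) else 0)"
      by (intro sum.cong) auto
    also have "\<dots> = (if j = 0 then 0 else x i ^ (j - 1) * (- x 0))"
      using that by (simp del: sum.op_ivl_Suc)
    finally show ?thesis by (cases j) (auto simp: algebra_simps)
  qed
  then have VU: "V * U = W"
    unfolding V_def U_def W_def
    by (intro eq_matI) (auto simp: scalar_prod_def simp del: sum.op_ivl_Suc)
  have "det U = 1"
    unfolding U_def by (rule det_unit_upper_triangular) auto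
  then have "det V = det W"
    using det_mult[of V "Suc n" U] unfolding VU by (simp add: V_def U_def)
  also have "det W = (\<Sum>j<Suc n. W $$ (0, j) * cofactor W 0 j)"
    by (rule laplace_expansion_row) (auto simp: W_def)
  also have "\<dots> = (\<Sum>j<Suc n. if j = 0 then cofactor W 0 0 else 0)"
    by (intro sum.cong) (auto simp: W_def)
  also have "\<dots> = det (mat_delete W 0 0)"
    by (simp add: cofactor_def del: sum.lessThan_Suc)
  \<comment> \<open>The factor 1 is the trivial column scaling that
    \<open>det_scale_rows_columns\<close> expects.\<close>
  also have "mat_delete W 0 0 = mat n n (\<lambda>(i, j). (x (Suc i) - x 0) * 1 * x (Suc i) ^ j)"
    unfolding mat_delete_def W_def by (intro eq_matI) (auto simp: mult.commute)
  also have "det \<dots> = (\<Prod>i = 0..<n. x (Suc i) - x 0) * det (mat n n (\<lambda>(i, j). x (Suc i) ^ j))"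
    by (subst det_scale_rows_columns) simp
  also have "\<dots> = (\<Prod>j<n. x (Suc j) - x 0) * (\<Prod>j<n. \<Prod>i<j. x (Suc j) - x (Suc i))"
    by (subst Suc.IH) (simp add: atLeast0LessThan)
  also have "\<dots> = (\<Prod>j<n. \<Prod>i<Suc j. x (Suc j) - x i)"
    unfolding prod.lessThan_Suc_shift by (simp add: prod.distrib)
  also have "\<dots> = (\<Prod>j<Suc n. \<Prod>i<j. x j - x i)"
    by (subst (2) prod.lessThan_Suc_shift) simp
  finally show ?case by (simp add: V_def)
qed

section \<open>Shapes, strips and tableaux\<close>

text \<open>Partitions with at most \<open>l\<close> parts, with rows counted from 0 and padded by
  zeros, so that the row below the last one can be addressed. The same \<open>l\<close> will be the
  size of the determinants.\<close>

definition shapes :: "nat \<Rightarrow> (nat \<Rightarrow> nat) set" where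
  "shapes l = {r. antimono r \<and> (\<forall>i\<ge>l. r i = 0)}"

text \<open>For even \<open>p\<close> the difference of \<open>r\<close> and \<open>m\<close> has at
  most one cell per column (horizontal strip), for odd \<open>p\<close> at most one cell per row
  (vertical strip).\<close>

definition strips :: "nat \<Rightarrow> (nat \<Rightarrow> nat) \<Rightarrow> (nat \<Rightarrow> nat) set" where
  "strips p r = {m. antimono m \<and> (\<forall>i. m i \<le> r i) \<and>
     (\<forall>i. if even p then r (Suc i) \<le> m i else r i \<le> Suc (m i))}"

text \<open>The rule for a value \<open>t\<close> depends on the parity of \<open>t + p\<close>: subtracting 1 from all entries is
  compensated by increasing \<open>p\<close>.\<close>

definition tableaux :: "nat \<Rightarrow> (nat \<Rightarrow> nat) \<Rightarrow> (nat \<Rightarrow> nat \<Rightarrow> nat) set" where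
  "tableaux p r = {T.
     (\<forall>i j. r i \<le> j \<longrightarrow> T i j = 0) \<and>
     (\<forall>i j k. j < k \<and> k < r i \<longrightarrow> T i k \<le> T i j \<and> (odd (T i j + p) \<longrightarrow> T i k < T i j)) \<and>
     (\<forall>i k j. i < k \<and> j < r k \<longrightarrow> T k j \<le> T i j \<and> (even (T i j + p) \<longrightarrow> T k j < T i j))}"

definition bounded_tableaux :: "nat \<Rightarrow> nat \<Rightarrow> (nat \<Rightarrow> nat) \<Rightarrow> (nat \<Rightarrow> nat \<Rightarrow> nat) set" where
  "bounded_tableaux N p r = {T \<in> tableaux p r. \<forall>i j. T i j \<le> N}"

lemma shapesD:
  assumes "r \<in> shapes l"
  shows "i \<le> k \<Longrightarrow> r k \<le> r i" "l \<le> i \<Longrightarrow> r i = 0"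
  using assms by (auto simp: shapes_def antimono_def)

lemma strips_shapes: "r \<in> shapes l \<Longrightarrow> m \<in> strips p r \<Longrightarrow> m \<in> shapes l"
  unfolding shapes_def strips_def mem_Collect_eq by (metis le_zero_eq)

lemma finite_bounded_shapes:
  assumes "r \<in> shapes l"
  shows "finite {m. \<forall>i. m i \<le> r i}"
proof -
  have "finite {m. \<forall>i. (i \<in> {..<l} \<longrightarrow> m i \<in> {..r 0}) \<and> (i \<notin> {..<l} \<longrightarrow> m i = 0)}"
    by (rule finite_set_of_finite_funs) auto
  moreover have "{m. \<forall>i. m i \<le> r i} \<subseteq>
      {m. \<forall>i. (i \<in> {..<l} \<longrightarrow> m i \<in> {..r 0}) \<and> (i \<notin> {..<l} \<longrightarrow> m i = 0)}"
  proof (intro subsetI CollectI allI conjI impI)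
    fix m i assume m: "m \<in> {m. \<forall>i. m i \<le> r i}"
    then have "m i \<le> r i" by simp
    then show "m i \<in> {..r 0}" using shapesD(1)[OF assms, of 0 i] by simp
    assume "i \<notin> {..<l}"
    then show "m i = 0" using \<open>m i \<le> r i\<close> shapesD(2)[OF assms, of i] by simp
  qed
  ultimately show ?thesis by (rule rev_finite_subset)
qed

lemma finite_strips: "r \<in> shapes l \<Longrightarrow> finite (strips p r)"
  by (rule finite_subset[OF _ finite_bounded_shapes]) (auto simp: strips_def)

lemma tableauxD:
  assumes "T \<in> tableaux p r"
  shows "r i \<le> j \<Longrightarrow> T i j = 0"
    "j < k \<Longrightarrow> k < r i \<Longrightarrow> T i k \<le> T i j"
    "j < k \<Longrightarrow> k < r i \<Longrightarrow> odd (T i j + p) \<Longrightarrow> T i k < T i j"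
    "i < k \<Longrightarrow> j < r k \<Longrightarrow> T k j \<le> T i j"
    "i < k \<Longrightarrow> j < r k \<Longrightarrow> even (T i j + p) \<Longrightarrow> T k j < T i j"
  using assms unfolding tableaux_def mem_Collect_eq by blast+

lemma tableauxI:
  assumes "\<And>i j. r i \<le> j \<Longrightarrow> T i j = 0"
    "\<And>i j k. j < k \<Longrightarrow> k < r i \<Longrightarrow> T i k \<le> T i j"
    "\<And>i j k. j < k \<Longrightarrow> k < r i \<Longrightarrow> odd (T i j + p) \<Longrightarrow> T i k < T i j"
    "\<And>i j k. i < k \<Longrightarrow> j < r k \<Longrightarrow> T k j \<le> T i j"
    "\<And>i j k. i < k \<Longrightarrow> j < r k \<Longrightarrow> even (T i j + p) \<Longrightarrow> T k j < T i j"
  shows "T \<in> tableaux p r"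
  unfolding tableaux_def mem_Collect_eq by (intro conjI allI impI; (elim conjE)?; rule assms; assumption)

section \<open>Peeling off the zero entries of a tableau\<close>

definition support_rows :: "(nat \<Rightarrow> nat \<Rightarrow> nat) \<Rightarrow> nat \<Rightarrow> nat" where
  "support_rows T i = card {j. 0 < T i j}"

text \<open>A downward closed proper set of naturals is an initial segment, and its cardinality is
  its first missing element. This serves for row lengths and for column lengths alike.\<close>

lemma less_card_Collect_iff:
  fixes P :: "nat \<Rightarrow> bool"
  assumes down: "\<And>j k. j \<le> k \<Longrightarrow> P k \<Longrightarrow> P j" and bound: "\<not> P b"
  shows "k < card {k. P k} \<longleftrightarrow> P k"
proof -
  define n where "n = (LEAST k. \<not> P k)"
  have "\<not> P n" unfolding n_def by (rule LeastI[of "\<lambda>k. \<not> P k", OF bound])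
  moreover have "P k" if "k < n" for k
    using not_less_Least[of k "\<lambda>k. \<not> P k"] that unfolding n_def by blast
  ultimately have iff: "P k \<longleftrightarrow> k < n" for k
    using down by (meson not_le)
  then have "{k. P k} = {..<n}" by auto
  then show ?thesis by (simp add: iff)
qed

lemma less_support_rows_iff:
  assumes T: "T \<in> tableaux p r"
  shows "j < support_rows T i \<longleftrightarrow> 0 < T i j"
  unfolding support_rows_def
proof (rule less_card_Collect_iff)
  fix j k assume "j \<le> k" "0 < T i k"
  moreover from this have "k < r i" using tableauxD(1)[OF T, of i k] by (cases "k < r i") auto
  ultimately show "0 < T i j"
    using tableauxD(2)[OF T, of j k i] by (cases "j = k") auto
qed (use tableauxD(1)[OF T, of i "r i"] in simp)

text \<open>For even \<open>p\<close> the value 0 cannot occur twice in a column, so a cell with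
  another cell of \<open>r\<close> below it is positive. For odd \<open>p\<close> it cannot occur
  twice in a row.\<close>

lemma support_rows_strips:
  assumes r: "antimono r" and T: "T \<in> tableaux p r"
  shows "support_rows T \<in> strips p r"
proof -
  note supp = less_support_rows_iff[OF T]
  have less: "j < r i" if "j < support_rows T i" for i j
    using that tableauxD(1)[OF T] supp by (metis less_irrefl not_le)
  have "support_rows T k \<le> support_rows T i" if "i \<le> k" for i k
  proof (cases "i = k")
    case False
    with that have "i < k" by simp
    have "j < support_rows T i" if "j < support_rows T k" for j
      using tableauxD(4)[OF T \<open>i < k\<close> less[OF that]] that supp by (metis less_le_trans)
    then show ?thesis by (meson not_le less_irrefl)
  qed simp
  moreover have "support_rows T i \<le> r i" for i
    using less by (meson not_le less_irrefl)
  moreover have "r (Suc i) \<le> support_rows T i" if "even p" for i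
  proof -
    have "j < support_rows T i" if "j < r (Suc i)" for j
      using tableauxD(5)[OF T _ that, of i] \<open>even p\<close> by (cases "T i j") (auto simp: supp)
    then show ?thesis by (meson not_le less_irrefl)
  qed
  moreover have "r i \<le> Suc (support_rows T i)" if "odd p" for i
  proof (rule ccontr)
    assume "\<not> ?thesis"
    then have "Suc (support_rows T i) < r i" by simp
    then show False
      using tableauxD(3)[OF T lessI, of "support_rows T i" i] supp[of "support_rows T i" i] that by auto
  qed
  ultimately show ?thesis by (auto simp: strips_def antimono_def)
qed

definition raise_tableau :: "(nat \<Rightarrow> nat) \<Rightarrow> (nat \<Rightarrow> nat \<Rightarrow> nat) \<Rightarrow> nat \<Rightarrow> nat \<Rightarrow> nat" where
  "raise_tableau m T i j = (if j < m i then Suc (T i j) else 0)"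

definition lower_tableau :: "(nat \<Rightarrow> nat \<Rightarrow> nat) \<Rightarrow> nat \<Rightarrow> nat \<Rightarrow> nat" where
  "lower_tableau T i j = T i j - 1"

text \<open>Lowering a positive entry and raising \<open>p\<close> leaves their sum, and hence the
  parity in the rules, unchanged.\<close>

lemma lower_tableau_mem:
  assumes T: "T \<in> tableaux p r"
  shows "lower_tableau T \<in> tableaux (Suc p) (support_rows T)"
proof -
  note supp = less_support_rows_iff[OF T]
  have supp': "support_rows T i \<le> j \<longleftrightarrow> T i j = 0" for i j
    using supp[of j i] by linarith
  have less: "j < r i" if "0 < T i j" for i j
    using that tableauxD(1)[OF T] by (metis less_irrefl not_le)
  have par: "even (t - 1 + Suc p) \<longleftrightarrow> even (t + p)" if "0 < t" for t
    using that by (cases t) auto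
  show ?thesis
  proof (rule tableauxI, unfold lower_tableau_def supp supp')
    fix i j k assume *: "j < k" "0 < T i k"
    then have "T i k \<le> T i j" using tableauxD(2)[OF T] less by blast
    then show "T i k - 1 \<le> T i j - 1" by simp
    assume "odd (T i j - 1 + Suc p)"
    then have "odd (T i j + p)" using par[of "T i j"] * \<open>T i k \<le> T i j\<close> by auto
    then have "T i k < T i j" using tableauxD(3)[OF T] less * by blast
    then show "T i k - 1 < T i j - 1" using * by linarith
  next
    fix i j k assume *: "i < k" "0 < T k j"
    then have "T k j \<le> T i j" using tableauxD(4)[OF T] less by blast
    then show "T k j - 1 \<le> T i j - 1" by simp
    assume "even (T i j - 1 + Suc p)"
    then have "even (T i j + p)" using par[of "T i j"] * \<open>T k j \<le> T i j\<close> by auto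
    then have "T k j < T i j" using tableauxD(5)[OF T] less * by blast
    then show "T k j - 1 < T i j - 1" using * by linarith
  qed auto
qed

lemma raise_tableau_mem:
  assumes r: "antimono r" and m: "m \<in> strips p r" and T: "T \<in> tableaux (Suc p) m"
  shows "raise_tableau m T \<in> tableaux p r"
proof (rule tableauxI)
  have am: "m k \<le> m i" if "i \<le> k" for i k
    using m that by (auto simp: strips_def antimono_def)
  have mr: "m i \<le> r i" for i using m by (auto simp: strips_def)
  show "r i \<le> j \<Longrightarrow> raise_tableau m T i j = 0" for i j
    using mr[of i] by (auto simp: raise_tableau_def)
  fix i j k
  {
    assume *: "j < k" "k < r i"
    show "raise_tableau m T i k \<le> raise_tableau m T i j"
      using tableauxD(2)[OF T, of j k i] * by (auto simp: raise_tableau_def)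
    assume odd: "odd (raise_tableau m T i j + p)"
    consider "k < m i" | "j < m i" "m i \<le> k" | "m i \<le> j" by linarith
    then show "raise_tableau m T i k < raise_tableau m T i j"
    proof cases
      case 1
      then show ?thesis using tableauxD(3)[OF T, of j k i] * odd by (auto simp: raise_tableau_def)
    next
      \<comment> \<open>The left entry is 0, so \<open>p\<close> is odd; a vertical strip leaves at
        most one cell of row \<open>i\<close> outside \<open>m\<close>, but both \<open>j\<close>
        and \<open>k\<close> lie there.\<close>
      case 3
      then have "odd p" using odd by (simp add: raise_tableau_def)
      then have "r i \<le> Suc (m i)" using m by (auto simp: strips_def)
      then show ?thesis using * 3 by linarith
    qed (auto simp: raise_tableau_def)
  }
  {
    assume *: "i < k" "j < r k"
    have "m k \<le> m i" using am * by simp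
    then show "raise_tableau m T k j \<le> raise_tableau m T i j"
      using tableauxD(4)[OF T, of i k j] * by (auto simp: raise_tableau_def)
    assume even: "even (raise_tableau m T i j + p)"
    consider "j < m k" | "j < m i" "m k \<le> j" | "m i \<le> j" by linarith
    then show "raise_tableau m T k j < raise_tableau m T i j"
    proof cases
      case 1
      then show ?thesis using tableauxD(5)[OF T, of i k j] * even \<open>m k \<le> m i\<close>
        by (auto simp: raise_tableau_def)
    next
      case 3
      then have "even p" using even by (simp add: raise_tableau_def)
      then have "r (Suc i) \<le> m i" using m by (auto simp: strips_def)
      moreover have "r k \<le> r (Suc i)" using r * by (auto simp: antimono_def)
      ultimately show ?thesis using * 3 by linarith
    qed (auto simp: raise_tableau_def)
  }
qed

lemma support_rows_raise_tableau: "support_rows (raise_tableau m T) = m"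
proof
  fix i
  have "{j. 0 < raise_tableau m T i j} = {..<m i}" by (auto simp: raise_tableau_def)
  then show "support_rows (raise_tableau m T) i = m i" by (simp add: support_rows_def)
qed

lemma lower_raise_tableau: "T \<in> tableaux p m \<Longrightarrow> lower_tableau (raise_tableau m T) = T"
  by (intro ext) (simp add: lower_tableau_def raise_tableau_def tableauxD(1))

lemma raise_lower_tableau:
  "T \<in> tableaux p r \<Longrightarrow> raise_tableau (support_rows T) (lower_tableau T) = T"
  by (intro ext) (simp add: lower_tableau_def raise_tableau_def less_support_rows_iff)

text \<open>Recording the support and lowering the positive entries is inverse to raising. Since
  this lowers the bound by one, it supports an induction on the bound.\<close>

lemma bounded_tableaux_bij:
  assumes r: "antimono r"
  shows "bij_betw (\<lambda>(m, T). raise_tableau m T)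
    (Sigma (strips p r) (bounded_tableaux N (Suc p))) (bounded_tableaux (Suc N) p r)"
proof (rule bij_betw_byWitness[where f' = "\<lambda>T. (support_rows T, lower_tableau T)"])
  show "(\<lambda>(m, T). raise_tableau m T) ` Sigma (strips p r) (bounded_tableaux N (Suc p))
      \<subseteq> bounded_tableaux (Suc N) p r"
    using raise_tableau_mem[OF r] by (auto simp: bounded_tableaux_def) (auto simp: raise_tableau_def)
  show "(\<lambda>T. (support_rows T, lower_tableau T)) ` bounded_tableaux (Suc N) p r
      \<subseteq> Sigma (strips p r) (bounded_tableaux N (Suc p))"
    using support_rows_strips[OF r] lower_tableau_mem
    by (auto simp: bounded_tableaux_def) (auto simp: lower_tableau_def le_diff_conv)
  show "\<forall>x\<in>Sigma (strips p r) (bounded_tableaux N (Suc p)).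
      (\<lambda>T. (support_rows T, lower_tableau T)) ((\<lambda>(m, T). raise_tableau m T) x) = x"
    using lower_raise_tableau by (force simp: bounded_tableaux_def support_rows_raise_tableau)
  show "\<forall>T\<in>bounded_tableaux (Suc N) p r.
      (\<lambda>(m, T). raise_tableau m T) (support_rows T, lower_tableau T) = T"
    using raise_lower_tableau by (force simp: bounded_tableaux_def)
qed

lemma finite_bounded_tableaux:
  assumes "r \<in> shapes l"
  shows "finite (bounded_tableaux N p r)"
  using assms
proof (induction N arbitrary: p r)
  case 0
  have "bounded_tableaux 0 p r \<subseteq> {\<lambda>i j. 0}" by (auto simp: bounded_tableaux_def)
  then show ?case by (rule finite_subset) simp
next
  case (Suc N)
  have "finite (Sigma (strips p r) (bounded_tableaux N (Suc p)))"
    using finite_strips[OF Suc.prems] Suc.IH strips_shapes[OF Suc.prems] by (intro finite_SigmaI) auto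
  moreover have "antimono r" using Suc.prems by (simp add: shapes_def)
  ultimately show ?case using bij_betw_finite[OF bounded_tableaux_bij] by blast
qed

section \<open>Weighted sums over bounded tableaux\<close>

locale overpartition_weights =
  fixes a q :: "'a :: field"
  assumes q_nonzero: "q \<noteq> 0" and q_power_ne_1: "0 < n \<Longrightarrow> q ^ n \<noteq> 1"
begin

text \<open>Decodes the value: both \<open>2 * n\<close> and \<open>2 * n - 1\<close> give
  \<open>q ^ n\<close>, and the odd one, which stands for an overlined \<open>n\<close>, also gives
  a factor \<open>a\<close>.\<close>

definition cell_weight :: "nat \<Rightarrow> 'a" where
  "cell_weight t = a ^ (t mod 2) * q ^ ((t + 1) div 2)"

text \<open>The parameter \<open>p\<close> is the total already subtracted from the entries, so
  \<open>T i j + p\<close> is the value to be weighed.\<close>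

definition tableau_weight :: "nat \<Rightarrow> nat \<Rightarrow> (nat \<Rightarrow> nat) \<Rightarrow> (nat \<Rightarrow> nat \<Rightarrow> nat) \<Rightarrow> 'a" where
  "tableau_weight l p r T = (\<Prod>i<l. \<Prod>j<r i. cell_weight (T i j + p))"

definition tableau_sum :: "nat \<Rightarrow> nat \<Rightarrow> nat \<Rightarrow> (nat \<Rightarrow> nat) \<Rightarrow> 'a" where
  "tableau_sum l N p r = (\<Sum>T\<in>bounded_tableaux N p r. tableau_weight l p r T)"

lemma tableau_weight_raise:
  assumes "m \<in> strips p r"
  shows "tableau_weight l p r (raise_tableau m T) =
    cell_weight p ^ (\<Sum>i<l. r i - m i) * tableau_weight l (Suc p) m T"
proof -
  have "(\<Prod>j<r i. cell_weight (raise_tableau m T i j + p)) =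
      cell_weight p ^ (r i - m i) * (\<Prod>j<m i. cell_weight (T i j + Suc p))" for i
  proof -
    have "m i \<le> r i" using assms by (auto simp: strips_def)
    then have "(\<Prod>j<r i. cell_weight (raise_tableau m T i j + p)) =
        (\<Prod>j<m i. cell_weight (raise_tableau m T i j + p)) *
        (\<Prod>j\<in>{m i..<r i}. cell_weight (raise_tableau m T i j + p))"
      by (simp add: lessThan_atLeast0 prod.atLeastLessThan_concat)
    also have "(\<Prod>j<m i. cell_weight (raise_tableau m T i j + p)) =
        (\<Prod>j<m i. cell_weight (T i j + Suc p))"
      by (intro prod.cong) (auto simp: raise_tableau_def)
    also have "(\<Prod>j\<in>{m i..<r i}. cell_weight (raise_tableau m T i j + p)) =
        (\<Prod>j\<in>{m i..<r i}. cell_weight p)"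
      by (intro prod.cong) (auto simp: raise_tableau_def)
    finally show ?thesis by simp
  qed
  then show ?thesis by (simp add: tableau_weight_def prod.distrib power_sum)
qed

lemma tableau_sum_Suc:
  assumes "r \<in> shapes l"
  shows "tableau_sum l (Suc N) p r =
    (\<Sum>m\<in>strips p r. cell_weight p ^ (\<Sum>i<l. r i - m i) * tableau_sum l N (Suc p) m)"
proof -
  have r: "antimono r" using assms by (simp add: shapes_def)
  have "tableau_sum l (Suc N) p r =
      (\<Sum>(m, T)\<in>Sigma (strips p r) (bounded_tableaux N (Suc p)). tableau_weight l p r (raise_tableau m T))"
    unfolding tableau_sum_def
    by (subst sum.reindex_bij_betw[OF bounded_tableaux_bij[OF r], symmetric]) (auto intro: sum.cong)
  also have "\<dots> = (\<Sum>m\<in>strips p r. \<Sum>T\<in>bounded_tableaux N (Suc p) m. tableau_weight l p r (raise_tableau m T))"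
    using finite_strips[OF assms] finite_bounded_tableaux[OF strips_shapes[OF assms]]
    by (subst sum.Sigma) auto
  also have "\<dots> = (\<Sum>m\<in>strips p r. cell_weight p ^ (\<Sum>i<l. r i - m i) * tableau_sum l N (Suc p) m)"
    unfolding tableau_sum_def sum_distrib_left by (intro sum.cong refl tableau_weight_raise)
  finally show ?thesis .
qed

lemma cell_weight_add_2: "cell_weight (Suc (Suc t)) = q * cell_weight t"
  by (simp add: cell_weight_def)

text \<open>Adding 2 preserves the parity rules and multiplies the weight of each cell of
  \<open>r\<close> by \<open>q\<close>.\<close>

lemma tableau_sum_parameter_add_2:
  "tableau_sum l N (Suc (Suc p)) r = q ^ (\<Sum>i<l. r i) * tableau_sum l N p r"
proof -
  have "tableau_weight l (Suc (Suc p)) r T = q ^ (\<Sum>i<l. r i) * tableau_weight l p r T" for T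
    by (simp add: tableau_weight_def cell_weight_add_2 power_sum prod.distrib)
  moreover have "bounded_tableaux N (Suc (Suc p)) r = bounded_tableaux N p r"
    by (simp add: bounded_tableaux_def tableaux_def)
  ultimately show ?thesis by (simp add: tableau_sum_def sum_distrib_left)
qed

text \<open>Two peelings: the cells of value 0 weigh 1, those of value 1 weigh \<open>a * q\<close>.
  The parameter is then 2 and returns to 0 by \<open>tableau_sum_parameter_add_2\<close>.\<close>

lemma tableau_sum_recurrence:
  assumes r: "r \<in> shapes l"
  shows "tableau_sum l (Suc (Suc N)) 0 r =
    (\<Sum>m\<in>strips 0 r. q ^ (\<Sum>i<l. m i) *
       (\<Sum>s\<in>strips 1 m. a ^ (\<Sum>i<l. m i - s i) * tableau_sum l N 0 s))"
proof -
  have "tableau_sum l (Suc N) 1 m =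
      q ^ (\<Sum>i<l. m i) * (\<Sum>s\<in>strips 1 m. a ^ (\<Sum>i<l. m i - s i) * tableau_sum l N 0 s)"
    if "m \<in> strips 0 r" for m
  proof -
    have "m \<in> shapes l" using strips_shapes[OF r that] .
    then have "tableau_sum l (Suc N) 1 m = (\<Sum>s\<in>strips 1 m.
        (a * q) ^ (\<Sum>i<l. m i - s i) * (q ^ (\<Sum>i<l. s i) * tableau_sum l N 0 s))"
      using tableau_sum_Suc[of m l N 1] tableau_sum_parameter_add_2[of l N 0]
      by (simp add: cell_weight_def)
    also have "\<dots> = (\<Sum>s\<in>strips 1 m.
        q ^ (\<Sum>i<l. m i) * (a ^ (\<Sum>i<l. m i - s i) * tableau_sum l N 0 s))"
    proof (intro sum.cong refl)
      fix s assume s: "s \<in> strips 1 m"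
      \<comment> \<open>The powers of \<open>q\<close> from the peeled cells and from the change of
        parameter combine to one power that does not depend on \<open>s\<close>.\<close>
      have "(\<Sum>i<l. m i) = (\<Sum>i<l. m i - s i) + (\<Sum>i<l. s i)"
        unfolding sum.distrib[symmetric] using s by (intro sum.cong) (auto simp: strips_def)
      then show "(a * q) ^ (\<Sum>i<l. m i - s i) * (q ^ (\<Sum>i<l. s i) * tableau_sum l N 0 s) =
          q ^ (\<Sum>i<l. m i) * (a ^ (\<Sum>i<l. m i - s i) * tableau_sum l N 0 s)"
        by (simp add: power_add power_mult_distrib mult_ac)
    qed
    finally show ?thesis by (simp add: sum_distrib_left)
  qed
  then show ?thesis
    using tableau_sum_Suc[OF r, of "Suc N" 0] by (simp add: cell_weight_def)
qed

end

section \<open>The Jacobi--Trudi determinant\<close>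

context overpartition_weights begin

text \<open>The extension by 0 to negative indices is the usual convention for complete homogeneous
  symmetric functions.\<close>

definition one_row :: "int \<Rightarrow> 'a" where
  "one_row n = (if n < 0 then 0 else \<Prod>k<nat n. (1 + a * q ^ Suc k) / (1 - q ^ Suc k))"

definition one_row_diff :: "int \<Rightarrow> 'a" where
  "one_row_diff n = q powi n * (one_row n + a * one_row (n - 1))"

definition jacobi_trudi :: "nat \<Rightarrow> (nat \<Rightarrow> nat) \<Rightarrow> 'a" where
  "jacobi_trudi l r = det (mat l l (\<lambda>(i, j). one_row (int (r i) - int i + int j)))"

lemma one_row_neg: "n < 0 \<Longrightarrow> one_row n = 0"
  and one_row_0: "one_row 0 = 1"
  by (simp_all add: one_row_def)

lemma one_row_Suc:
  "one_row (1 + int n) * (1 - q ^ Suc n) = one_row (int n) * (1 + a * q ^ Suc n)"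
proof -
  have "nat (1 + int n) = Suc n" by simp
  then have "one_row (1 + int n) = one_row (int n) * ((1 + a * q ^ Suc n) / (1 - q ^ Suc n))"
    by (simp add: one_row_def)
  moreover have "1 - q ^ Suc n \<noteq> 0" using q_power_ne_1[of "Suc n"] by simp
  ultimately show ?thesis by simp
qed

text \<open>For positive \<open>n\<close> this rearranges the quotient of consecutive products, as
  in \<open>one_row_Suc\<close>. The convention for negative indices extends it to all integers, so
  it applies to every entry of the determinant.\<close>

lemma one_row_difference: "one_row n - one_row (n - 1) = one_row_diff n"
proof -
  consider "n < 0" | "n = 0" | m where "n = 1 + int m"
    by (metis add.commute int_one_le_iff_zero_less linorder_neqE_linordered_idom zle_iff_zadd)
  then show ?thesis
  proof cases
    case 3
    have "q powi (1 + int m) = q ^ Suc m" by (simp flip: of_nat_Suc)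
    then have "one_row n - one_row (n - 1) - one_row_diff n =
        one_row (1 + int m) * (1 - q ^ Suc m) - one_row (int m) * (1 + a * q ^ Suc m)"
      using 3 by (simp add: one_row_diff_def algebra_simps)
    then show ?thesis by (simp only: one_row_Suc) simp
  qed (simp_all add: one_row_diff_def one_row_neg one_row_0)
qed

section \<open>Row differences and horizontal strips\<close>

lemma sum_one_row_diff:
  fixes u v :: nat
  assumes "u \<le> v"
  shows "(\<Sum>m = u..v. one_row_diff (int m + c)) = one_row (int v + c) - one_row (int u - 1 + c)"
  using assms
proof (induction v rule: dec_induct)
  case base
  show ?case using one_row_difference[of "int u + c"] by (simp add: algebra_simps)
next
  case (step v)
  then show ?case using one_row_difference[of "int (Suc v) + c"] by (simp add: algebra_simps)
qed

text \<open>The inequalities \<open>r (Suc i) \<le> m i \<le> r i\<close> bound each row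
  independently and already force \<open>m\<close> to be decreasing, so horizontal strips form a
  product of intervals.\<close>

lemma bij_betw_strips_0_PiE:
  assumes "r \<in> shapes l"
  shows "bij_betw (\<lambda>m. restrict m {0..<l}) (strips 0 r) (PiE {0..<l} (\<lambda>i. {r (Suc i)..r i}))"
proof (rule bij_betw_byWitness[where f' = "\<lambda>f i. if i < l then f i else 0"])
  have zero: "m i = 0" if "m \<in> strips 0 r" "l \<le> i" for m i
    using shapesD(2)[OF strips_shapes[OF assms that(1)] that(2)] .
  then show "\<forall>m\<in>strips 0 r. (\<lambda>i. if i < l then restrict m {0..<l} i else 0) = m"
    by (auto simp: fun_eq_iff)
  show "\<forall>f\<in>PiE {0..<l} (\<lambda>i. {r (Suc i)..r i}). restrict (\<lambda>i. if i < l then f i else 0) {0..<l} = f"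
    by (auto simp: fun_eq_iff PiE_def extensional_def)
  show "(\<lambda>m. restrict m {0..<l}) ` strips 0 r \<subseteq> PiE {0..<l} (\<lambda>i. {r (Suc i)..r i})"
    by (auto simp: strips_def)
  show "(\<lambda>f i. if i < l then f i else 0) ` PiE {0..<l} (\<lambda>i. {r (Suc i)..r i}) \<subseteq> strips 0 r"
  proof clarify
    fix f assume f: "f \<in> PiE {0..<l} (\<lambda>i. {r (Suc i)..r i})"
    define m where "m i = (if i < l then f i else 0)" for i
    have m: "r (Suc i) \<le> m i" "m i \<le> r i" for i
      using f shapesD(2)[OF assms, of "Suc i"] by (auto simp: m_def PiE_def Pi_def)
    then have "antimono m" by (metis antimono_iff_le_Suc le_trans)
    with m have "m \<in> strips 0 r" by (simp add: strips_def)
    then show "(\<lambda>i. if i < l then f i else 0) \<in> strips 0 r" by (simp add: m_def[abs_def])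
  qed
qed

text \<open>Subtracting from each row the next one gives entries that telescope into sums of
  \<open>one_row_diff\<close> over the interval allowed for \<open>m i\<close>. Multilinearity then
  sums over all horizontal strips.\<close>

lemma jacobi_trudi_horizontal:
  assumes r: "r \<in> shapes l"
  shows "jacobi_trudi l r =
    (\<Sum>m\<in>strips 0 r. det (mat l l (\<lambda>(i, j). one_row_diff (int (m i) - int i + int j))))"
proof -
  have "(\<lambda>i j. one_row (int (r i) - int i + int j) - one_row (int (r (Suc i)) - int (Suc i) + int j)) =
      (\<lambda>i j. \<Sum>s\<in>{r (Suc i)..r i}. one_row_diff (int s - int i + int j))"
  proof (intro ext)
    fix i j
    have "r (Suc i) \<le> r i" using shapesD(1)[OF r] by simp
    then show "one_row (int (r i) - int i + int j) - one_row (int (r (Suc i)) - int (Suc i) + int j) =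
        (\<Sum>s\<in>{r (Suc i)..r i}. one_row_diff (int s - int i + int j))"
      using sum_one_row_diff[of "r (Suc i)" "r i" "int j - int i"] by (simp add: algebra_simps)
  qed
  \<comment> \<open>Row \<open>l\<close> would have only negative indices, so the last row also
    counts as a difference.\<close>
  moreover have "one_row (int (r l) - int l + int j) = 0" if "j < l" for j
    using that shapesD(2)[OF r, of l] by (simp add: one_row_neg)
  ultimately have "jacobi_trudi l r =
      det (mat l l (\<lambda>(i, j). \<Sum>s\<in>{r (Suc i)..r i}. one_row_diff (int s - int i + int j)))"
    unfolding jacobi_trudi_def
    using det_row_differences[of l "\<lambda>i j. one_row (int (r i) - int i + int j)"] by (simp add: fun_eq_iff)
  also have "\<dots> = (\<Sum>f\<in>PiE {0..<l} (\<lambda>i. {r (Suc i)..r i}).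
      det (mat l l (\<lambda>(i, j). one_row_diff (int (f i) - int i + int j))))"
    by (rule det_row_sums) simp
  also have "\<dots> = (\<Sum>m\<in>strips 0 r.
      det (mat l l (\<lambda>(i, j). one_row_diff (int (restrict m {0..<l} i) - int i + int j))))"
    by (rule sum.reindex_bij_betw[OF bij_betw_strips_0_PiE[OF r], symmetric])
  also have "\<dots> = (\<Sum>m\<in>strips 0 r. det (mat l l (\<lambda>(i, j). one_row_diff (int (m i) - int i + int j))))"
    by (intro sum.cong refl arg_cong[where f = det] cong_mat) auto
  finally show ?thesis .
qed

section \<open>Multilinearity and vertical strips\<close>

lemma det_one_row_eq_0_equal_rows:
  assumes "x i = x (Suc i) - 1" "Suc i < l"
  shows "det (mat l l (\<lambda>(i, j). one_row (x i - int i + int j))) = 0"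
proof (rule det_identical_rows)
  show "row (mat l l (\<lambda>(i, j). one_row (x i - int i + int j))) i =
      row (mat l l (\<lambda>(i, j). one_row (x i - int i + int j))) (Suc i)"
    using assms by (intro eq_vecI) (auto simp: diff_diff_eq)
qed (use assms in auto)

lemma det_one_row_eq_0_negative:
  assumes "x l < 0"
  shows "det (mat (Suc l) (Suc l) (\<lambda>(i, j). one_row (x i - int i + int j))) = 0"
  by (subst laplace_expansion_row[of _ "Suc l" l]) (use assms in \<open>auto simp: one_row_neg intro!: sum.neutral\<close>)

text \<open>If \<open>m - e\<close> is not a partition, then two neighbouring rows coincide or the
  last row vanishes. The proof is by contraposition: a nonzero determinant makes
  \<open>m - e\<close> a vertical strip.\<close>

lemma det_one_row_eq_0:
  assumes m: "m \<in> shapes l" and e: "e \<in> PiE {0..<l} (\<lambda>_. {0, 1})"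
    and notin: "e \<notin> (\<lambda>s. restrict (\<lambda>i. m i - s i) {0..<l}) ` strips 1 m"
  shows "det (mat l l (\<lambda>(i, j). one_row (int (m i) - int (e i) - int i + int j))) = 0"
proof (rule ccontr)
  assume nz: "\<not> ?thesis"
  have e01: "e i \<le> 1" if "i < l" for i using e that by (auto simp: PiE_def Pi_def)
  have no_eq: "m i + e (Suc i) + 1 \<noteq> m (Suc i) + e i" if "Suc i < l" for i
  proof
    assume "m i + e (Suc i) + 1 = m (Suc i) + e i"
    then have "int (m i) - int (e i) = int (m (Suc i)) - int (e (Suc i)) - 1" by linarith
    then show False
      using nz det_one_row_eq_0_equal_rows[of "\<lambda>i. int (m i) - int (e i)" i l] that by simp
  qed
  have last: "e k \<le> m k" if "l = Suc k" for k
  proof (rule ccontr)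
    assume "\<not> e k \<le> m k"
    then have "int (m k) - int (e k) < 0" by linarith
    then show False using nz det_one_row_eq_0_negative[of "\<lambda>i. int (m i) - int (e i)" k] that by simp
  qed
  \<comment> \<open>Upwards from the last row: if row \<open>n\<close> had \<open>m n = 0\<close>
    and \<open>e n = 1\<close>, then row \<open>Suc n\<close> would have both equal to 0, which
    gives equal rows.\<close>
  have le: "e i \<le> m i" if "i < l" for i
  proof -
    obtain k where k: "l = Suc k" using \<open>i < l\<close> by (cases l) auto
    then have "i \<le> k" using that by simp
    then show ?thesis
    proof (induction i rule: inc_induct)
      case base
      show ?case using last k by simp
    next
      case (step n)
      then show ?case
        using no_eq[of n] e01[of n] e01[of "Suc n"] shapesD(1)[OF m, of n "Suc n"] k by simp
    qed
  qed
  define s where "s i = (if i < l then m i - e i else 0)" for i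
  have "s (Suc i) \<le> s i" for i
    using no_eq[of i] e01[of i] e01[of "Suc i"] shapesD(1)[OF m, of i "Suc i"] le[of i] le[of "Suc i"]
    by (auto simp: s_def)
  then have "antimono s" by (simp add: antimono_iff_le_Suc)
  moreover have "s i \<le> m i" "m i \<le> Suc (s i)" for i
    using e01[of i] le[of i] shapesD(2)[OF m, of i] by (auto simp: s_def)
  ultimately have "s \<in> strips 1 m" by (simp add: strips_def)
  moreover have "e = restrict (\<lambda>i. m i - s i) {0..<l}"
    using e le by (auto simp: fun_eq_iff s_def PiE_def extensional_def)
  ultimately show False using notin by blast
qed

text \<open>The power of \<open>q\<close> in each entry splits into a row and a column factor. The
  remaining entry has two summands, and choosing one per row means removing 0 or 1 cells from that
  row, with a factor \<open>a\<close> per removed cell.\<close>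

lemma jacobi_trudi_vertical:
  assumes m: "m \<in> shapes l"
  shows "det (mat l l (\<lambda>(i, j). one_row_diff (int (m i) - int i + int j))) =
    q ^ (\<Sum>i<l. m i) * (\<Sum>s\<in>strips 1 m. a ^ (\<Sum>i<l. m i - s i) * jacobi_trudi l s)"
proof -
  define E :: "(nat \<Rightarrow> nat) set" where "E = PiE {0..<l} (\<lambda>_. {0, 1})"
  define G where "G e = a ^ (\<Sum>i<l. e i) *
    det (mat l l (\<lambda>(i, j). one_row (int (m i) - int (e i) - int i + int j)))" for e :: "nat \<Rightarrow> nat"
  \<comment> \<open>The exponents \<open>- i\<close> of the rows cancel against the exponents
    \<open>j\<close> of the columns.\<close>
  have "(\<Prod>i = 0..<l. q powi (int (m i) - int i)) * (\<Prod>j = 0..<l. q powi int j) =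
      (\<Prod>i = 0..<l. q ^ m i)"
    unfolding prod.distrib[symmetric]
    by (intro prod.cong refl) (simp add: q_nonzero power_int_diff)
  then have scale: "(\<Prod>i = 0..<l. q powi (int (m i) - int i)) * (\<Prod>j = 0..<l. q powi int j) =
      q ^ (\<Sum>i<l. m i)"
    by (simp add: power_sum atLeast0LessThan)
  have "det (mat l l (\<lambda>(i, j). one_row_diff (int (m i) - int i + int j))) =
      det (mat l l (\<lambda>(i, j). q powi (int (m i) - int i) * q powi int j *
        (\<Sum>e\<in>{0, 1::nat}. a ^ e * one_row (int (m i) - int e - int i + int j))))"
    by (intro arg_cong[where f = det] cong_mat)
       (simp_all add: one_row_diff_def power_int_add q_nonzero, simp add: algebra_simps)
  also have "\<dots> = q ^ (\<Sum>i<l. m i) * det (mat l l (\<lambda>(i, j).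
        \<Sum>e\<in>{0, 1::nat}. a ^ e * one_row (int (m i) - int e - int i + int j)))"
    unfolding det_scale_rows_columns scale ..
  also have "det (mat l l (\<lambda>(i, j).
        \<Sum>e\<in>{0, 1::nat}. a ^ e * one_row (int (m i) - int e - int i + int j))) =
      (\<Sum>e\<in>E. det (mat l l (\<lambda>(i, j). a ^ e i * one_row (int (m i) - int (e i) - int i + int j))))"
    unfolding E_def by (rule det_row_sums) simp
  also have "\<dots> = (\<Sum>e\<in>E. G e)"
    unfolding G_def
    using det_scale_rows_columns[of l "\<lambda>i. a ^ e i" "\<lambda>_. 1" for e]
    by (intro sum.cong refl) (simp add: power_sum atLeast0LessThan)
  also have "\<dots> = (\<Sum>e\<in>(\<lambda>s. restrict (\<lambda>i. m i - s i) {0..<l}) ` strips 1 m. G e)"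
  proof (rule sum.mono_neutral_right)
    show "finite E" unfolding E_def by (intro finite_PiE) auto
    show "(\<lambda>s. restrict (\<lambda>i. m i - s i) {0..<l}) ` strips 1 m \<subseteq> E"
      unfolding E_def
    proof (intro image_subsetI restrict_PiE_iff[THEN iffD2] ballI)
      fix s i assume "s \<in> strips 1 m"
      then have "m i \<le> Suc (s i)" by (simp add: strips_def)
      then show "m i - s i \<in> {0, 1}" by auto
    qed
    show "\<forall>e\<in>E - (\<lambda>s. restrict (\<lambda>i. m i - s i) {0..<l}) ` strips 1 m. G e = 0"
      using det_one_row_eq_0[OF m] by (auto simp: E_def G_def)
  qed
  also have "\<dots> = (\<Sum>s\<in>strips 1 m. G (restrict (\<lambda>i. m i - s i) {0..<l}))"
  proof (rule sum.reindex_cong[OF _ refl refl])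
    show "inj_on (\<lambda>s. restrict (\<lambda>i. m i - s i) {0..<l}) (strips 1 m)"
    proof (rule inj_onI, rule ext)
      fix s t i
      assume st: "s \<in> strips 1 m" "t \<in> strips 1 m"
        and eq: "restrict (\<lambda>i. m i - s i) {0..<l} = restrict (\<lambda>i. m i - t i) {0..<l}"
      have "s i \<le> m i" "t i \<le> m i" using st by (auto simp: strips_def)
      moreover have "m i - s i = m i - t i"
        using fun_cong[OF eq, of i] shapesD(2)[OF m, of i] by (cases "i < l") auto
      ultimately show "s i = t i" by linarith
    qed
  qed
  also have "\<dots> = (\<Sum>s\<in>strips 1 m. a ^ (\<Sum>i<l. m i - s i) * jacobi_trudi l s)"
    unfolding G_def jacobi_trudi_def
    by (intro sum.cong refl arg_cong2[where f = "(*)"] arg_cong[where f = det] cong_mat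
          arg_cong[where f = "(^) a"])
       (auto simp: strips_def of_nat_diff)
  finally show ?thesis .
qed

theorem jacobi_trudi_recurrence:
  assumes "r \<in> shapes l"
  shows "jacobi_trudi l r = (\<Sum>m\<in>strips 0 r. q ^ (\<Sum>i<l. m i) *
    (\<Sum>s\<in>strips 1 m. a ^ (\<Sum>i<l. m i - s i) * jacobi_trudi l s))"
  unfolding jacobi_trudi_horizontal[OF assms]
  by (intro sum.cong refl jacobi_trudi_vertical strips_shapes[OF assms])

end

section \<open>Evaluation by hooks\<close>

text \<open>Hook length with rows and columns counted from 0: arm \<open>r i - t - 1\<close>, leg
  \<open>card {k. t < r k} - i - 1\<close>, and the cell itself. Inside the diagram the subtraction
  is not truncated.\<close>

definition hook :: "(nat \<Rightarrow> nat) \<Rightarrow> nat \<Rightarrow> nat \<Rightarrow> nat" where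
  "hook r i t = r i + card {k. t < r k} - i - t - 1"

lemma less_column_iff:
  assumes "r \<in> shapes l"
  shows "k < card {k. t < r k} \<longleftrightarrow> t < r k"
  by (rule less_card_Collect_iff[where b = l])
     (use shapesD[OF assms] in \<open>auto intro: less_le_trans\<close>)

text \<open>The classical complementation of hooks: with the strictly decreasing numbers
  \<open>b i\<close>, the hook lengths of row \<open>i\<close> and the differences to later
  \<open>b j\<close> together exhaust \<open>{1..b i}\<close>. Both families are injective and
  disjoint, so counting suffices.\<close>

lemma hooks_union_differences:
  assumes r: "r \<in> shapes l" and i: "i < l"
  defines "b \<equiv> \<lambda>i. r i + (l - 1 - i)"
  shows "inj_on (hook r i) {..<r i}" "inj_on (\<lambda>j. b i - b j) {i<..<l}"
    "hook r i ` {..<r i} \<inter> (\<lambda>j. b i - b j) ` {i<..<l} = {}"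
    "hook r i ` {..<r i} \<union> (\<lambda>j. b i - b j) ` {i<..<l} = {1..b i}"
proof -
  define c where "c t = card {k. t < r k}" for t
  have c: "k < c t \<longleftrightarrow> t < r k" for k t unfolding c_def by (rule less_column_iff[OF r])
  have hook: "hook r i t + i + t + 1 = r i + c t" and col: "i < c t" "c t \<le> l" if "t < r i" for t
  proof -
    show "i < c t" using c that by simp
    then show "hook r i t + i + t + 1 = r i + c t" using that by (simp add: hook_def c_def)
    show "c t \<le> l" using c[of l t] shapesD(2)[OF r, of l] by simp
  qed
  have b: "b i - b j + r j + i = r i + j" "b j < b i" if "i < j" "j < l" for j
    using that shapesD(1)[OF r, of i j] unfolding b_def by linarith+
  have mono_c: "c t' \<le> c t" if "t \<le> t'" for t t'
    using c that by (meson le_less_trans not_le order_refl)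
  show inj1: "inj_on (hook r i) {..<r i}"
  proof (rule linorder_inj_onI)
    fix t t' assume "t < t'" "t \<in> {..<r i}" "t' \<in> {..<r i}"
    then show "hook r i t \<noteq> hook r i t'"
      using hook(1)[of t] hook(1)[of t'] mono_c[of t t'] by simp
  qed auto
  show inj2: "inj_on (\<lambda>j. b i - b j) {i<..<l}"
  proof (rule linorder_inj_onI)
    fix j j' assume "j < j'" "j \<in> {i<..<l}" "j' \<in> {i<..<l}"
    then show "b i - b j \<noteq> b i - b j'"
      using b(1)[of j] b(1)[of j'] shapesD(1)[OF r, of j j'] by simp
  qed auto
  \<comment> \<open>Equality would mean \<open>c t + r j = j + t + 1\<close>. But
    \<open>j < c t\<close> holds exactly if \<open>t < r j\<close>, so the left side is at least
    \<open>j + t + 2\<close> or at most \<open>j + t\<close>.\<close>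
  show disj: "hook r i ` {..<r i} \<inter> (\<lambda>j. b i - b j) ` {i<..<l} = {}"
  proof -
    have "hook r i t \<noteq> b i - b j" if "t < r i" "i < j" "j < l" for t j
      using hook(1)[of t] b(1)[of j] c[of j t] that by linarith
    then show ?thesis by auto
  qed
  have sub: "hook r i ` {..<r i} \<union> (\<lambda>j. b i - b j) ` {i<..<l} \<subseteq> {1..b i}"
  proof -
    have "hook r i t \<in> {1..b i}" if "t < r i" for t
      using hook[of t] col[of t] that i by (auto simp: b_def)
    moreover have "b i - b j \<in> {1..b i}" if "i < j" "j < l" for j
      using b(2)[OF that] by auto
    ultimately show ?thesis by auto
  qed
  have "card (hook r i ` {..<r i} \<union> (\<lambda>j. b i - b j) ` {i<..<l}) =
      card (hook r i ` {..<r i}) + card ((\<lambda>j. b i - b j) ` {i<..<l})"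
    by (rule card_Un_disjoint[OF _ _ disj]) simp_all
  also have "\<dots> = card {..<r i} + card {i<..<l}"
    by (simp only: card_image[OF inj1] card_image[OF inj2])
  also have "\<dots> = card {1..b i}"
    using i by (simp add: b_def)
  finally have "card (hook r i ` {..<r i} \<union> (\<lambda>j. b i - b j) ` {i<..<l}) = card {1..b i}" .
  then show "hook r i ` {..<r i} \<union> (\<lambda>j. b i - b j) ` {i<..<l} = {1..b i}"
    by (rule card_subset_eq[OF finite_atLeastAtMost sub])
qed

lemma prod_hooks:
  fixes g :: "nat \<Rightarrow> 'b :: comm_monoid_mult"
  assumes "r \<in> shapes l" "i < l"
  shows "(\<Prod>t<r i. g (hook r i t)) *
      (\<Prod>j\<in>{i<..<l}. g (r i + (l - 1 - i) - (r j + (l - 1 - j)))) =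
    (\<Prod>k = 1..r i + (l - 1 - i). g k)"
  unfolding hooks_union_differences(4)[OF assms, symmetric]
  by (subst prod.union_disjoint)
     (use hooks_union_differences(1-3)[OF assms] in \<open>simp_all only: prod.reindex o_def finite_imageI
        finite_lessThan finite_greaterThanLessThan\<close>)

lemma prod_pairs_swap:
  fixes g :: "nat \<Rightarrow> nat \<Rightarrow> 'b :: comm_monoid_mult"
  shows "(\<Prod>j<l. \<Prod>i<j. g i j) = (\<Prod>i<l. \<Prod>j\<in>{i<..<l}. g i j)"
proof -
  have "(\<Prod>j<l. \<Prod>i<j. g i j) = (\<Prod>j\<in>{..<l}. \<Prod>i | i \<in> {..<l} \<and> i < j. g i j)"
    by (intro prod.cong) auto
  also have "\<dots> = (\<Prod>i\<in>{..<l}. \<Prod>j | j \<in> {..<l} \<and> i < j. g i j)"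
    by (rule prod.swap_restrict) auto
  also have "\<dots> = (\<Prod>i<l. \<Prod>j\<in>{i<..<l}. g i j)"
    by (intro prod.cong) auto
  finally show ?thesis .
qed

lemma poly_altdef_lessThan:
  fixes p :: "'b :: comm_semiring_1 poly"
  assumes "degree p < n"
  shows "poly p x = (\<Sum>k<n. coeff p k * x ^ k)"
proof -
  have "(\<Sum>k<n. coeff p k * x ^ k) = (\<Sum>k\<le>degree p. coeff p k * x ^ k)"
    using assms by (intro sum.mono_neutral_right) (auto simp: coeff_eq_0)
  then show ?thesis by (simp add: poly_altdef)
qed

section \<open>Factorisation through a Vandermonde matrix\<close>

context overpartition_weights begin

text \<open>The numerators start at the exponent \<open>2 - l\<close> instead of 1. This makes the
  quotient of \<open>one_row (int n - int j)\<close> by it a polynomial in \<open>q ^ n\<close> for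
  all \<open>j < l\<close>, and it is why factors with exponents from \<open>2 - l\<close> to 0 must
  not vanish.\<close>

definition row_factor :: "nat \<Rightarrow> nat \<Rightarrow> 'a" where
  "row_factor l n = (\<Prod>k<n. (1 + a * q powi (int k + 2 - int l)) / (1 - q ^ Suc k))"

text \<open>That quotient up to a constant: the surplus numerators of \<open>row_factor\<close> and
  the surplus denominators, as \<open>l - 1\<close> linear factors in the variable
  \<open>q ^ n\<close>.\<close>

definition column_poly :: "nat \<Rightarrow> nat \<Rightarrow> 'a poly" where
  "column_poly l j = (\<Prod>k<l - 1 - j. [:1, a * q powi (int k + 2 - int l):]) *
     (\<Prod>k<j. [:1, - (q powi (- int k)):])"

lemma degree_column_poly:
  assumes "j < l"
  shows "degree (column_poly l j) < l"
proof -
  have "degree (column_poly l j) \<le> (\<Sum>k<l - 1 - j. degree [:1, a * q powi (int k + 2 - int l):]) +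
      (\<Sum>k<j. degree [:1, - (q powi (- int k)):])"
    unfolding column_poly_def
    by (intro order.trans[OF degree_mult_le] add_mono order.trans[OF degree_prod_sum_le])
       (simp_all add: o_def)
  also have "\<dots> \<le> (\<Sum>k<l - 1 - j. 1) + (\<Sum>k<j. 1)"
    by (intro add_mono sum_mono) simp_all
  finally show ?thesis using assms by simp
qed

lemma poly_column_poly:
  "poly (column_poly l j) (q ^ n) =
    (\<Prod>k<l - 1 - j. 1 + a * q powi (int k + 2 - int l + int n)) *
    (\<Prod>k<j. 1 - q powi (int n - int k))"
proof -
  have "q powi (int k + 2 - int l) * q ^ n = q powi (int k + 2 - int l + int n)" for k
    by (simp add: power_int_add q_nonzero)
  moreover have "q powi (- int k) * q ^ n = q powi (int n - int k)" for k
    by (simp add: power_int_diff power_int_minus q_nonzero field_simps)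
  ultimately show ?thesis
    by (simp add: column_poly_def poly_prod mult.commute mult.left_commute mult.assoc)
qed

text \<open>For \<open>n < j\<close> both sides vanish, the right one by the factor with
  \<open>k = n\<close>. At \<open>n = j\<close> they agree because \<open>one_row 0 = 1\<close>, and
  from there on they satisfy the same first-order recurrence in \<open>n\<close>.\<close>

lemma one_row_eq_row_factor_poly:
  assumes "j < l"
    and nz: "\<And>e. 2 - int l \<le> e \<Longrightarrow> e \<le> 0 \<Longrightarrow> 1 + a * q powi e \<noteq> 0"
  shows "one_row (int n - int j) * (row_factor l j * poly (column_poly l j) (q ^ j)) =
    row_factor l n * poly (column_poly l j) (q ^ n)"
proof (cases "j \<le> n")
  case False
  then have "(\<Prod>k<j. 1 - q powi (int n - int k)) = 0" by (intro prod_zero) (auto intro!: bexI[of _ n])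
  then show ?thesis using False by (simp add: one_row_neg poly_column_poly)
next
  case True
  then show ?thesis
  proof (induction n rule: dec_induct)
    case base
    show ?case by (simp add: one_row_0)
  next
    case (step n)
    let ?P = "\<lambda>n. \<Prod>k<l - 1 - j. 1 + a * q powi (int k + 2 - int l + int n)"
    let ?Q = "\<lambda>n. \<Prod>k<j. 1 - q powi (int n - int k)"
    define d where "d = n - j"
    have n: "n = d + j" using step d_def by simp
    have l: "int (l - 1 - j) = int l - 1 - int j" using \<open>j < l\<close> by simp
    \<comment> \<open>Both products run over windows of consecutive exponents. Passing to
      \<open>Suc n\<close> shifts each window by one, exchanging a single factor at either
      end.\<close>
    have "?P (Suc n) * (1 + a * q powi (int n + 2 - int l)) =
        (\<Prod>k<Suc (l - 1 - j). 1 + a * q powi (int k + 2 - int l + int n))"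
      by (subst prod.lessThan_Suc_shift) (simp add: algebra_simps)
    also have "\<dots> = ?P n * (1 + a * q ^ Suc d)"
    proof -
      have "int (l - 1 - j) + 2 - int l + int n = int (Suc d)" using l n by simp
      then show ?thesis by (simp only: prod.lessThan_Suc power_int_of_nat)
    qed
    finally have P: "?P (Suc n) * (1 + a * q powi (int n + 2 - int l)) = ?P n * (1 + a * q ^ Suc d)" .
    have "?Q (Suc n) * (1 - q ^ Suc d) = (\<Prod>k<Suc j. 1 - q powi (int (Suc n) - int k))"
    proof -
      have "int (Suc n) - int j = int (Suc d)" using n by simp
      then show ?thesis by (simp only: prod.lessThan_Suc power_int_of_nat)
    qed
    also have "\<dots> = (1 - q ^ Suc n) * ?Q n"
    proof -
      have "q powi (int (Suc n) - int 0) = q ^ Suc n"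
        by (simp only: of_nat_0 diff_0_right power_int_of_nat)
      then show ?thesis by (subst prod.lessThan_Suc_shift) simp
    qed
    finally have Q: "?Q (Suc n) * (1 - q ^ Suc d) = (1 - q ^ Suc n) * ?Q n" .
    have f: "row_factor l (Suc n) * (1 - q ^ Suc n) = row_factor l n * (1 + a * q powi (int n + 2 - int l))"
      using q_power_ne_1[of "Suc n"] by (simp add: row_factor_def)
    have h: "one_row (int (Suc n) - int j) * (1 - q ^ Suc d) = one_row (int n - int j) * (1 + a * q ^ Suc d)"
      using one_row_Suc[of d] n by (simp add: algebra_simps)
    have ne: "1 - q ^ Suc d \<noteq> 0" "1 - q ^ Suc n \<noteq> 0"
      using q_power_ne_1[of "Suc d"] q_power_ne_1[of "Suc n"] by simp_all
    define K where "K = row_factor l j * poly (column_poly l j) (q ^ j)"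
    have IH: "one_row (int n - int j) * K = row_factor l n * (?P n * ?Q n)"
      using step.IH by (simp add: K_def poly_column_poly)
    have "one_row (int (Suc n) - int j) * K * (1 - q ^ Suc d) * (1 - q ^ Suc n) =
        (one_row (int (Suc n) - int j) * (1 - q ^ Suc d)) * K * (1 - q ^ Suc n)"
      by (simp only: ac_simps)
    also have "\<dots> = (one_row (int n - int j) * K) * (1 + a * q ^ Suc d) * (1 - q ^ Suc n)"
      unfolding h by (simp only: ac_simps)
    also have "\<dots> = row_factor l n * (?P n * (1 + a * q ^ Suc d)) * ((1 - q ^ Suc n) * ?Q n)"
      unfolding IH by (simp only: ac_simps)
    also have "\<dots> = (row_factor l n * (1 + a * q powi (int n + 2 - int l))) * ?P (Suc n) *
        (?Q (Suc n) * (1 - q ^ Suc d))"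
      unfolding P[symmetric] Q[symmetric] by (simp only: ac_simps)
    also have "\<dots> = row_factor l (Suc n) * (?P (Suc n) * ?Q (Suc n)) * (1 - q ^ Suc d) * (1 - q ^ Suc n)"
      unfolding f[symmetric] by (simp only: ac_simps)
    finally show ?case
      using ne unfolding K_def poly_column_poly by (simp only: mult_cancel_right simp_thms)
  qed
qed

lemma column_constant_nonzero:
  assumes "j < l"
    and nz: "\<And>e. 2 - int l \<le> e \<Longrightarrow> e \<le> 0 \<Longrightarrow> 1 + a * q powi e \<noteq> 0"
  shows "row_factor l j * poly (column_poly l j) (q ^ j) \<noteq> 0"
proof -
  have "row_factor l j \<noteq> 0"
    unfolding row_factor_def using nz q_power_ne_1[of "Suc _"] \<open>j < l\<close> by (auto simp del: power_Suc)
  moreover have "(\<Prod>k<l - 1 - j. 1 + a * q powi (int k + 2 - int l + int j)) \<noteq> 0"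
    using nz by auto
  moreover have "1 - q powi (int j - int k) \<noteq> 0" if "k < j" for k
  proof -
    have "int j - int k = int (j - k)" using that by simp
    then have "q powi (int j - int k) = q ^ (j - k)" by (simp only: power_int_of_nat)
    then show ?thesis using q_power_ne_1[of "j - k"] that by simp
  qed
  ultimately show ?thesis by (simp add: poly_column_poly)
qed

text \<open>The matrix is a diagonal matrix of row factors times a Vandermonde matrix times the
  matrix of coefficients of the column polynomials. Only the last is independent of
  \<open>r\<close>, and its determinant is \<open>c\<close>.\<close>

lemma jacobi_trudi_eq_vandermonde:
  assumes nz: "\<And>e. 2 - int l \<le> e \<Longrightarrow> e \<le> 0 \<Longrightarrow> 1 + a * q powi e \<noteq> 0"
  obtains c where "\<And>r. jacobi_trudi l r = c * (\<Prod>i<l. row_factor l (r i + (l - 1 - i))) *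
    (\<Prod>j<l. \<Prod>i<j. q ^ (r j + (l - 1 - j)) - q ^ (r i + (l - 1 - i)))"
proof -
  define P where "P j = Polynomial.smult (inverse (row_factor l j * poly (column_poly l j) (q ^ j))) (column_poly l j)" for j
  have P: "one_row (int n - int j) = row_factor l n * poly (P j) (q ^ n)" if "j < l" for n j
    using one_row_eq_row_factor_poly[OF that nz, of n] column_constant_nonzero[OF that nz]
    by (simp add: P_def field_simps)
  define C where "C = mat l l (\<lambda>(k, j). coeff (P (l - 1 - j)) k)"
  have "jacobi_trudi l r = det C * (\<Prod>i<l. row_factor l (r i + (l - 1 - i))) *
    (\<Prod>j<l. \<Prod>i<j. q ^ (r j + (l - 1 - j)) - q ^ (r i + (l - 1 - i)))" for r
  proof -
    define x where "x i = q ^ (r i + (l - 1 - i))" for i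
    define V where "V = mat l l (\<lambda>(i, k). x i ^ k)"
    have "one_row (int (r i) - int i + int j) =
        row_factor l (r i + (l - 1 - i)) * 1 * (V * C) $$ (i, j)" if "i < l" "j < l" for i j
    proof -
      \<comment> \<open>Reversing the columns writes the index as a natural number depending on the
        row minus one depending on the column.\<close>
      have "int (r i) - int i + int j = int (r i + (l - 1 - i)) - int (l - 1 - j)"
        using that by simp
      then have "one_row (int (r i) - int i + int j) =
          row_factor l (r i + (l - 1 - i)) * poly (P (l - 1 - j)) (x i)"
        using P[of "l - 1 - j" "r i + (l - 1 - i)"] that by (simp only: x_def)
      also have "poly (P (l - 1 - j)) (x i) = (\<Sum>k<l. coeff (P (l - 1 - j)) k * x i ^ k)"
        using that degree_column_poly[of "l - 1 - j" l]
        by (intro poly_altdef_lessThan) (auto simp: P_def intro: le_less_trans[OF degree_smult_le])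
      also have "\<dots> = (V * C) $$ (i, j)"
        using that by (simp add: V_def C_def scalar_prod_def mult.commute atLeast0LessThan)
      finally show ?thesis by simp
    qed
    then have "jacobi_trudi l r =
        det (mat l l (\<lambda>(i, j). row_factor l (r i + (l - 1 - i)) * 1 * (V * C) $$ (i, j)))"
      unfolding jacobi_trudi_def by (intro arg_cong[where f = det] cong_mat) auto
    also have "\<dots> = (\<Prod>i<l. row_factor l (r i + (l - 1 - i))) * det (mat l l (\<lambda>(i, j). (V * C) $$ (i, j)))"
      by (subst det_scale_rows_columns) (simp add: atLeast0LessThan)
    also have "mat l l (\<lambda>(i, j). (V * C) $$ (i, j)) = V * C"
      by (intro eq_matI) (auto simp: V_def C_def)
    also have "det (V * C) = det V * det C"
      by (rule det_mult[of _ l]) (auto simp: V_def C_def)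
    also have "det V = (\<Prod>j<l. \<Prod>i<j. x j - x i)"
      unfolding V_def by (rule det_vandermonde)
    finally show ?thesis by (simp add: x_def mult_ac)
  qed
  then show ?thesis by (rule that)
qed

lemma jacobi_trudi_empty: "jacobi_trudi l (\<lambda>_. 0) = 1"
  unfolding jacobi_trudi_def
  by (rule det_unit_upper_triangular) (simp_all add: one_row_neg one_row_0)

lemma row_factor_add:
  "row_factor l (n + m) = row_factor l n *
    (\<Prod>t<m. (1 + a * q powi (int (n + t) + 2 - int l)) / (1 - q ^ Suc (n + t)))"
  by (induction m) (simp_all add: row_factor_def)

text \<open>From each difference the smaller power, \<open>q\<close> to the \<open>b j\<close>, is
  taken out, \<open>j\<close> times for every \<open>j\<close>. The rest is the product over
  \<open>{1..b i}\<close> without the hooks, by \<open>prod_hooks\<close>.\<close>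

lemma row_factors_vandermonde:
  assumes r: "r \<in> shapes l"
  shows "(\<Prod>i<l. row_factor l (r i + (l - 1 - i))) *
      (\<Prod>j<l. \<Prod>i<j. q ^ (r j + (l - 1 - j)) - q ^ (r i + (l - 1 - i))) =
    (\<Prod>i<l. row_factor l (r i + (l - 1 - i)) * q ^ (i * (r i + (l - 1 - i))) *
      (\<Prod>k = 1..r i + (l - 1 - i). 1 - q ^ k) / (\<Prod>t<r i. 1 - q ^ hook r i t))"
proof -
  define b where "b i = r i + (l - 1 - i)" for i
  have "q ^ b j - q ^ b i = q ^ b j * (1 - q ^ (b i - b j))" if "i < j" "j < l" for i j
  proof -
    have "b j \<le> b i" using shapesD(1)[OF r, of i j] that by (simp add: b_def)
    then show ?thesis by (simp add: algebra_simps flip: power_add)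
  qed
  then have "(\<Prod>j<l. \<Prod>i<j. q ^ b j - q ^ b i) =
      (\<Prod>j<l. \<Prod>i<j. q ^ b j * (1 - q ^ (b i - b j)))"
    by (intro prod.cong) auto
  also have "\<dots> = (\<Prod>j<l. q ^ (j * b j)) * (\<Prod>i<l. \<Prod>j\<in>{i<..<l}. 1 - q ^ (b i - b j))"
    unfolding prod.distrib prod_pairs_swap[symmetric] by (simp add: mult.commute flip: power_mult)
  also have "(\<Prod>i<l. \<Prod>j\<in>{i<..<l}. 1 - q ^ (b i - b j)) =
      (\<Prod>i<l. (\<Prod>k = 1..b i. 1 - q ^ k) / (\<Prod>t<r i. 1 - q ^ hook r i t))"
  proof (intro prod.cong refl)
    fix i assume "i \<in> {..<l}"
    then have i: "i < l" by simp
    have "hook r i t \<in> {1..b i}" if "t < r i" for t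
      using hooks_union_differences(4)[OF r i] that unfolding b_def by blast
    then have "(\<Prod>t<r i. 1 - q ^ hook r i t) \<noteq> 0"
      using q_power_ne_1 by fastforce
    then show "(\<Prod>j\<in>{i<..<l}. 1 - q ^ (b i - b j)) =
        (\<Prod>k = 1..b i. 1 - q ^ k) / (\<Prod>t<r i. 1 - q ^ hook r i t)"
      using prod_hooks[OF r i, of "\<lambda>k. 1 - q ^ k"] by (simp add: b_def nonzero_eq_divide_eq mult.commute)
  qed
  finally show ?thesis
    by (simp add: b_def prod.distrib prod_dividef)
qed

text \<open>The unknown constant is eliminated by comparison with the empty shape, whose determinant
  is 1; the comparison is made row by row.\<close>

lemma jacobi_trudi_hook_product_aux:
  assumes r: "r \<in> shapes l"
    and nz: "\<And>e. 2 - int l \<le> e \<Longrightarrow> e \<le> 0 \<Longrightarrow> 1 + a * q powi e \<noteq> 0"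
  shows "jacobi_trudi l r = q ^ (\<Sum>i<l. i * r i) *
    (\<Prod>i<l. \<Prod>t<r i. (1 + a * q powi (int t - int i + 1)) / (1 - q ^ hook r i t))"
proof -
  define b where "b r i = r i + (l - 1 - i)" for r :: "nat \<Rightarrow> nat" and i
  define G where "G r = (\<Prod>i<l. row_factor l (b r i) * q ^ (i * b r i) *
      (\<Prod>k = 1..b r i. 1 - q ^ k) / (\<Prod>t<r i. 1 - q ^ hook r i t))" for r
  obtain c where c: "jacobi_trudi l r = c * (\<Prod>i<l. row_factor l (r i + (l - 1 - i))) *
      (\<Prod>j<l. \<Prod>i<j. q ^ (r j + (l - 1 - j)) - q ^ (r i + (l - 1 - i)))" for r
    using jacobi_trudi_eq_vandermonde[OF nz] by blast
  have jt: "jacobi_trudi l s = c * G s" if "s \<in> shapes l" for s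
    unfolding c G_def b_def row_factors_vandermonde[OF that, symmetric] by (rule mult.assoc)
  let ?z = "\<lambda>_. 0 :: nat"
  have z: "?z \<in> shapes l" by (simp add: shapes_def antimono_def)
  have one: "c * G ?z = 1"
    using jt[OF z] by (simp only: jacobi_trudi_empty)
  have "row_factor l (b r i) * q ^ (i * b r i) *
        (\<Prod>k = 1..b r i. 1 - q ^ k) / (\<Prod>t<r i. 1 - q ^ hook r i t) =
      row_factor l (b ?z i) * q ^ (i * b ?z i) * (\<Prod>k = 1..b ?z i. 1 - q ^ k) *
        (q ^ (i * r i) * (\<Prod>t<r i. (1 + a * q powi (int t - int i + 1)) / (1 - q ^ hook r i t)))"
    if i: "i < l" for i
  proof -
    define n where "n = l - 1 - i"
    define D where "D = (\<Prod>t<r i. 1 - q ^ Suc (n + t))"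
    have "D \<noteq> 0" unfolding D_def using q_power_ne_1[of "Suc _"] by (auto simp del: power_Suc)
    have b: "b r i = n + r i" "b ?z i = n" by (simp_all add: b_def n_def)
    \<comment> \<open>The numerators that row \<open>i\<close> gains over the empty shape have as
      exponents the contents plus 1.\<close>
    have "int (n + t) + 2 - int l = int t - int i + 1" for t
      using i by (simp add: n_def)
    then have rf: "row_factor l (n + r i) =
        row_factor l n * (\<Prod>t<r i. 1 + a * q powi (int t - int i + 1)) / D"
      unfolding row_factor_add by (simp only: prod_dividef D_def times_divide_eq_right)
    have "(\<Prod>k = 1..n + m. 1 - q ^ k) = (\<Prod>k = 1..n. 1 - q ^ k) * (\<Prod>t<m. 1 - q ^ Suc (n + t))" for m
      by (induction m) simp_all
    then have pk: "(\<Prod>k = 1..n + r i. 1 - q ^ k) = (\<Prod>k = 1..n. 1 - q ^ k) * D"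
      unfolding D_def .
    \<comment> \<open>The denominators \<open>D\<close> gained by the row factor cancel against the
      factors gained by the product over \<open>{1..b i}\<close>.\<close>
    have "x * y / D * (u * v) * (w * D) / H = x * u * w * (v * (y / H))" for x y u v w H :: 'a
      using \<open>D \<noteq> 0\<close> by (simp add: mult_ac)
    then show ?thesis
      unfolding b rf pk prod_dividef distrib_left power_add .
  qed
  then have G: "G r = G ?z * (\<Prod>i<l. q ^ (i * r i) *
      (\<Prod>t<r i. (1 + a * q powi (int t - int i + 1)) / (1 - q ^ hook r i t)))"
    unfolding G_def prod.distrib[symmetric] by (intro prod.cong) simp_all
  show ?thesis
    unfolding jt[OF r] G mult.assoc[symmetric] one
    unfolding mult_1_left prod.distrib power_sum ..
qed

text \<open>If \<open>a = -1\<close>, a column of length at least two makes both sides vanish.\<close>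

theorem jacobi_trudi_hook_product:
  assumes r: "r \<in> shapes l" and pos: "\<And>i. i < l \<Longrightarrow> 0 < r i"
    and nz: "\<And>e. e < 0 \<Longrightarrow> 1 + a * q powi e \<noteq> 0"
  shows "jacobi_trudi l r = q ^ (\<Sum>i<l. i * r i) *
    (\<Prod>i<l. \<Prod>t<r i. (1 + a * q powi (int t - int i + 1)) / (1 - q ^ hook r i t))"
proof (cases "1 + a = 0 \<and> 1 < l")
  case False
  \<comment> \<open>The exponent 0 lies in the range only for \<open>l\<close> at least 2, where
    this case provides that \<open>1 + a\<close> is nonzero.\<close>
  have "1 + a * q powi e \<noteq> 0" if "2 - int l \<le> e" "e \<le> 0" for e
    using False nz[of e] that by (cases "e = 0") auto
  then show ?thesis by (rule jacobi_trudi_hook_product_aux[OF r])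
next
  case True
  then have a: "a = - 1" by (simp add: add_eq_0_iff)
  have one_row_1: "one_row n = 1" if "0 \<le> n" for n
  proof -
    have "(1 + a * q ^ Suc k) / (1 - q ^ Suc k) = 1" for k
      using q_power_ne_1[of "Suc k"] a by simp
    then show ?thesis using that by (simp add: one_row_def)
  qed
  have "0 < r 0" "0 < r 1" using pos True by auto
  have "jacobi_trudi l r = 0"
    unfolding jacobi_trudi_def
  proof (rule det_identical_rows)
    show "row (mat l l (\<lambda>(i, j). one_row (int (r i) - int i + int j))) 0 =
        row (mat l l (\<lambda>(i, j). one_row (int (r i) - int i + int j))) 1"
      using True \<open>0 < r 1\<close> by (intro eq_vecI) (auto simp: one_row_1)
  qed (use True in auto)
  \<comment> \<open>The first cell of the second row has content -1 and contributes
    \<open>1 + a\<close>.\<close>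
  moreover have "(\<Prod>t<r 1. (1 + a * q powi (int t - int 1 + 1)) / (1 - q ^ hook r 1 t)) = 0"
    using \<open>0 < r 1\<close> a by (intro prod_zero bexI[of _ 0]) auto
  then have "(\<Prod>i<l. \<Prod>t<r i. (1 + a * q powi (int t - int i + 1)) / (1 - q ^ hook r i t)) = 0"
    by (rule prod_zero[OF finite_lessThan bexI[of _ 1]]) (use True in auto)
  ultimately show ?thesis by simp
qed

end

section \<open>Convergence\<close>

lemma fls_X_power_mult_nth: "fls_nth (fls_X ^ n * f) k = fls_nth f (k - int n)"
  by (simp add: fls_X_power_times_conv_shift)

text \<open>The metric is the X-adic one: agreement of all coefficients below \<open>n\<close>
  bounds the distance by \<open>inverse (2 ^ n)\<close>.\<close>

lemma dist_fls_less:
  assumes "0 < (e :: real)"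
  obtains n :: nat
  where "\<And>x y :: 'k :: group_add fls. (\<And>k. k < int n \<Longrightarrow> fls_nth (x - y) k = 0) \<Longrightarrow> dist x y < e"
proof -
  obtain n where n: "inverse (2 ^ n) < e"
    using real_arch_pow_inv[of e "1 / 2"] assms by (auto simp: power_one_over inverse_eq_divide)
  have "dist x y < e" if "\<And>k. k < int n \<Longrightarrow> fls_nth (x - y) k = 0" for x y :: "'k fls"
  proof (cases "x = y")
    case False
    then have "int n \<le> fls_subdegree (x - y)"
      using that by (intro fls_subdegree_geI) auto
    then have "n \<le> nat (fls_subdegree (x - y))" and "0 \<le> fls_subdegree (x - y)" by linarith+
    then have "dist x y = inverse (2 ^ nat (fls_subdegree (x - y)))"
      using False by (simp add: dist_fls_def)
    also have "\<dots> \<le> inverse (2 ^ n)"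
      using \<open>n \<le> nat (fls_subdegree (x - y))\<close> by simp
    finally show ?thesis using n by linarith
  qed (use assms in simp)
  then show ?thesis by (rule that)
qed

context overpartition_weights begin

lemma tableau_weight_altdef:
  "tableau_weight l p r T = a ^ (\<Sum>i<l. \<Sum>j<r i. (T i j + p) mod 2) *
     q ^ (\<Sum>i<l. \<Sum>j<r i. (T i j + p + 1) div 2)"
  by (simp add: tableau_weight_def cell_weight_def prod.distrib power_sum)

lemma strips_zero: "strips p (\<lambda>_. 0) = {\<lambda>_. 0}"
  by (auto simp: strips_def antimono_def)

lemma tableau_sum_zero: "tableau_sum l N p (\<lambda>_. 0) = 1"
proof -
  have "bounded_tableaux N p (\<lambda>_. 0) = {\<lambda>_ _. 0}"
    by (auto simp: bounded_tableaux_def tableaux_def fun_eq_iff)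
  then show ?thesis by (simp add: tableau_sum_def tableau_weight_def)
qed

lemma tableau_sum_diff_recurrence:
  assumes "r \<in> shapes l"
  shows "tableau_sum l (Suc (Suc N)) 0 r - jacobi_trudi l r =
    (\<Sum>m\<in>strips 0 r. q ^ (\<Sum>i<l. m i) * (\<Sum>s\<in>strips 1 m. a ^ (\<Sum>i<l. m i - s i) *
       (tableau_sum l N 0 s - jacobi_trudi l s)))"
  by (subst tableau_sum_recurrence[OF assms], subst jacobi_trudi_recurrence[OF assms])
     (simp add: sum_subtractf right_diff_distrib)

end

section \<open>Specialisation to formal Laurent series\<close>

locale overpartition_series =
  fixes \<alpha> :: "'k :: field"
begin

sublocale overpartition_weights "fls_const \<alpha>" "fls_X :: 'k fls"
proof
  show "fls_X ^ n \<noteq> (1 :: 'k fls)" if "0 < n" for n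
  proof
    assume "fls_X ^ n = (1 :: 'k fls)"
    then have "fls_nth (fls_X ^ n :: 'k fls) 0 = 1" by simp
    with that show False by simp
  qed
qed simp

text \<open>The constant coefficient is 1, as a nonzero power of \<open>fls_X\<close> has
  none.\<close>

lemma one_plus_powi_nonzero:
  assumes "e \<noteq> 0"
  shows "1 + fls_const \<alpha> * fls_X powi e \<noteq> 0"
proof
  assume *: "1 + fls_const \<alpha> * fls_X powi e = 0"
  have "fls_nth (fls_const \<alpha> * fls_X powi e) 0 = 0"
    using assms by (cases "0 \<le> e") (auto simp: power_int_def fls_inverse_X fls_X_inv_power_nth)
  then show False using arg_cong[OF *, of "\<lambda>f. fls_nth f 0"] assms by simp
qed

text \<open>By the recurrence for the error, each step gains at least one power of \<open>q\<close>
  from a nonempty \<open>m\<close>, while the empty \<open>m\<close> contributes no error. The order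
  of the error thus grows with \<open>N\<close>.\<close>

lemma tableau_sum_converges:
  assumes r: "r \<in> shapes l"
  obtains c where "\<And>N k. k < int N - c \<Longrightarrow> fls_nth (tableau_sum l (2 * N) 0 r - jacobi_trudi l r) k = 0"
proof -
  define S where "S = {s \<in> shapes l. \<forall>i. s i \<le> r i}"
  define d where "d N s = tableau_sum l (2 * N) 0 s - jacobi_trudi l s" for N s
  \<comment> \<open>A common bound for the initial errors of the finitely many shapes inside
    \<open>r\<close>, since the recurrence passes to smaller shapes.\<close>
  define c where "c = - Min ((\<lambda>s. fls_subdegree (d 0 s)) ` S)"
  have "finite S"
    unfolding S_def by (rule finite_subset[OF _ finite_bounded_shapes[OF r]]) auto
  have S_strips: "m \<in> S" if "s \<in> S" "m \<in> strips p s" for m s p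
    using that strips_shapes[of s l m p] unfolding S_def strips_def by (auto intro: le_trans)
  have "fls_nth (d N s) k = 0" if "s \<in> S" "k < int N - c" for N k s
    using that
  proof (induction N arbitrary: s k)
    case 0
    then have "- c \<le> fls_subdegree (d 0 s)"
      unfolding c_def using \<open>finite S\<close> by simp
    with 0 show ?case by simp
  next
    case (Suc N)
    have s: "s \<in> shapes l" using Suc.prems by (simp add: S_def)
    have "fls_nth (d (Suc N) s) k = (\<Sum>m\<in>strips 0 s.
       fls_nth (\<Sum>t\<in>strips 1 m. fls_const \<alpha> ^ (\<Sum>i<l. m i - t i) * d N t)
         (k - int (\<Sum>i<l. m i)))"
      using tableau_sum_diff_recurrence[OF s, of "2 * N"]
      by (simp add: d_def fls_nth_sum fls_X_power_mult_nth del: of_nat_sum)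
    also have "\<dots> = 0"
    proof (rule sum.neutral, rule ballI)
      fix m assume m: "m \<in> strips 0 s"
      show "fls_nth (\<Sum>t\<in>strips 1 m. fls_const \<alpha> ^ (\<Sum>i<l. m i - t i) * d N t)
          (k - int (\<Sum>i<l. m i)) = 0"
      proof (cases "m = (\<lambda>_. 0)")
        case True
        then show ?thesis
          by (simp add: strips_zero d_def tableau_sum_zero jacobi_trudi_empty)
      next
        case False
        have "m \<in> S" using S_strips Suc.prems(1) m by blast
        have "0 < (\<Sum>i<l. m i)"
        proof (rule ccontr)
          assume "\<not> ?thesis"
          then have "m i = 0" for i
            using shapesD(2)[OF strips_shapes[OF s m], of i] by (cases "i < l") auto
          with False show False by auto
        qed
        then have "k - int (\<Sum>i<l. m i) < int N - c" using Suc.prems by linarith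
        then have "fls_nth (d N t) (k - int (\<Sum>i<l. m i)) = 0" if "t \<in> strips 1 m" for t
          using Suc.IH S_strips[OF \<open>m \<in> S\<close> that] by blast
        then show ?thesis
          by (simp add: fls_nth_sum del: of_nat_sum flip: fls_const_power)
      qed
    qed
    finally show ?case .
  qed
  moreover have "r \<in> S" using r by (simp add: S_def)
  ultimately show ?thesis by (intro that[of c]) (simp add: d_def)
qed

text \<open>A single entry above \<open>2 * N\<close> already contributes an exponent of at least
  \<open>N\<close> to \<open>q\<close>.\<close>

lemma tableau_weight_nth:
  assumes T: "T \<in> tableaux 0 r" and r: "r \<in> shapes l" and large: "2 * N < T i j" and k: "k < int N"
  shows "fls_nth (tableau_weight l 0 r T) k = 0"
proof -
  have "j < r i" using tableauxD(1)[OF T, of i j] large by (cases "j < r i") auto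
  then have "i < l" using shapesD(2)[OF r, of i] by (cases "i < l") auto
  have "N \<le> (T i j + 0 + 1) div 2" using large by linarith
  also have "\<dots> \<le> (\<Sum>j<r i. (T i j + 0 + 1) div 2)"
    using \<open>j < r i\<close> by (intro member_le_sum) auto
  also have "\<dots> \<le> (\<Sum>i<l. \<Sum>j<r i. (T i j + 0 + 1) div 2)"
    using \<open>i < l\<close> by (intro member_le_sum[where f = "\<lambda>i. \<Sum>j<r i. (T i j + 0 + 1) div 2"]) auto
  finally have "k < int (\<Sum>i<l. \<Sum>j<r i. (T i j + 0 + 1) div 2)" using k by linarith
  then show ?thesis
    unfolding tableau_weight_altdef fls_const_power[symmetric] fls_mult_const_nth fls_X_power_nth
    by (simp del: of_nat_sum)
qed

theorem has_sum_tableau_weight: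
  assumes r: "r \<in> shapes l"
  shows "(tableau_weight l 0 r has_sum jacobi_trudi l r) (tableaux 0 r)"
  unfolding has_sum_def
proof (rule tendstoI)
  fix e :: real assume "0 < e"
  then obtain n where n: "\<And>x y :: 'k fls. (\<And>k. k < int n \<Longrightarrow> fls_nth (x - y) k = 0) \<Longrightarrow> dist x y < e"
    using dist_fls_less by blast
  obtain c where c: "\<And>N k. k < int N - c \<Longrightarrow> fls_nth (tableau_sum l (2 * N) 0 r - jacobi_trudi l r) k = 0"
    using tableau_sum_converges[OF r] by blast
  \<comment> \<open>Large enough that both the error of the bounded sum and the weights of all
    unbounded tableaux vanish below order \<open>n\<close>.\<close>
  define N where "N = n + nat c"
  show "\<forall>\<^sub>F Y in finite_subsets_at_top (tableaux 0 r). dist (sum (tableau_weight l 0 r) Y) (jacobi_trudi l r) < e"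
    unfolding eventually_finite_subsets_at_top
  proof (intro exI[of _ "bounded_tableaux (2 * N) 0 r"] conjI allI impI)
    show "finite (bounded_tableaux (2 * N) 0 r)" by (rule finite_bounded_tableaux[OF r])
    show "bounded_tableaux (2 * N) 0 r \<subseteq> tableaux 0 r" by (auto simp: bounded_tableaux_def)
    fix Y assume Y: "finite Y \<and> bounded_tableaux (2 * N) 0 r \<subseteq> Y \<and> Y \<subseteq> tableaux 0 r"
    show "dist (sum (tableau_weight l 0 r) Y) (jacobi_trudi l r) < e"
    proof (rule n)
      fix k assume k: "k < int n"
      have "sum (tableau_weight l 0 r) Y = sum (tableau_weight l 0 r) (Y - bounded_tableaux (2 * N) 0 r) +
          tableau_sum l (2 * N) 0 r"
        unfolding tableau_sum_def using Y by (intro sum.subset_diff) auto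
      then have "fls_nth (sum (tableau_weight l 0 r) Y - jacobi_trudi l r) k =
          (\<Sum>T\<in>Y - bounded_tableaux (2 * N) 0 r. fls_nth (tableau_weight l 0 r T) k) +
          fls_nth (tableau_sum l (2 * N) 0 r - jacobi_trudi l r) k"
        by (simp add: fls_nth_sum)
      also have "fls_nth (tableau_sum l (2 * N) 0 r - jacobi_trudi l r) k = 0"
        using k by (intro c) (simp add: N_def)
      also have "(\<Sum>T\<in>Y - bounded_tableaux (2 * N) 0 r. fls_nth (tableau_weight l 0 r T) k) = 0"
      proof (rule sum.neutral, rule ballI)
        fix T assume T: "T \<in> Y - bounded_tableaux (2 * N) 0 r"
        then have "T \<in> tableaux 0 r" using Y by blast
        moreover obtain i j where "2 * N < T i j"
          using T \<open>T \<in> tableaux 0 r\<close> by (auto simp: bounded_tableaux_def not_le)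
        ultimately show "fls_nth (tableau_weight l 0 r T) k = 0"
          using r k by (intro tableau_weight_nth[where N = N]) (auto simp: N_def)
      qed
      finally show "fls_nth (sum (tableau_weight l 0 r) Y - jacobi_trudi l r) k = 0" by simp
    qed
  qed
qed

end

section \<open>Fillings as tableaux\<close>

lemma partition_of_shape:
  assumes m: "m \<in> shapes l"
  obtains mu where "is_partition mu" "\<And>i. part mu (Suc i) = m i"
proof
  define n where "n = card {i. 0 < m i}"
  have n: "i < n \<longleftrightarrow> 0 < m i" for i
    unfolding n_def by (rule less_card_Collect_iff[where b = l])
      (use shapesD[OF m] in \<open>auto intro: less_le_trans\<close>)
  have "sorted_wrt (\<ge>) (map m [0..<n])"
    by (auto simp: sorted_wrt_iff_nth_less intro!: shapesD(1)[OF m])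
  then show "is_partition (map m [0..<n])"
    using n by (auto simp: is_partition_def)
  show "part (map m [0..<n]) (Suc i) = m i" for i
    using n[of i] by (auto simp: part_def)
qed

lemma shape_of_partition:
  assumes "is_partition lam"
  shows "(\<lambda>i. part lam (Suc i)) \<in> shapes (length lam)"
proof -
  have "part lam (Suc k) \<le> part lam (Suc i)" if "i \<le> k" for i k
    using assms that by (cases "i = k") (auto simp: is_partition_def part_def sorted_wrt_iff_nth_less)
  then show ?thesis by (auto simp: shapes_def antimono_def part_def)
qed

text \<open>Cells are shifted to start at 0. As \<open>2 * n - 1 < 2 * n\<close>, an overlined
  \<open>n\<close> comes after a plain one in weakly decreasing order, which is what the rules for
  rows and columns ask for.\<close>

definition tableau_of_filling :: "filling \<Rightarrow> nat \<Rightarrow> nat \<Rightarrow> nat" where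
  "tableau_of_filling P i j =
     (case P (Suc i, Suc j) of None \<Rightarrow> 0 | Some (n, b) \<Rightarrow> 2 * n - of_bool b)"

definition filling_of_tableau :: "(nat \<Rightarrow> nat \<Rightarrow> nat) \<Rightarrow> filling" where
  "filling_of_tableau T = (\<lambda>(i, j). if 1 \<le> i \<and> 1 \<le> j \<and> 0 < T (i - 1) (j - 1)
     then Some ((T (i - 1) (j - 1) + 1) div 2, odd (T (i - 1) (j - 1))) else None)"

lemma tableau_of_filling_of_tableau: "tableau_of_filling (filling_of_tableau T) = T"
proof (intro ext)
  fix i j
  have "2 * ((t + 1) div 2) - of_bool (odd t) = t" for t :: nat
  proof (cases "even t")
    case True
    then have "2 * ((t + 1) div 2) = t" by presburger
    with True show ?thesis by simp
  next
    case False
    then have "2 * ((t + 1) div 2) - 1 = t" by presburger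
    with False show ?thesis by simp
  qed
  then show "tableau_of_filling (filling_of_tableau T) i j = T i j"
    by (simp add: tableau_of_filling_def filling_of_tableau_def)
qed

text \<open>The bounds on the row lengths say that the cells of \<open>lam\<close> left empty form a
  horizontal strip, which is the rule for the even value 0.\<close>

lemma overpartitions_between_dom:
  assumes "P \<in> overpartitions_between lam"
  obtains m where "dom P = {(Suc i, Suc j) |i j. j < m i}" "\<And>i. m i \<le> part lam (Suc i)"
    "\<And>i. part lam (Suc (Suc i)) \<le> m i" "antimono m"
proof -
  obtain mu where mu: "plane_overpartition mu P"
    and "\<forall>i\<ge>1. part lam (i + 1) \<le> part mu i \<and> part mu i \<le> part lam i"
    using assms by (auto simp: overpartitions_between_def)
  then have bounds: "part mu (Suc i) \<le> part lam (Suc i)" "part lam (Suc (Suc i)) \<le> part mu (Suc i)" for i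
    by (metis Suc_eq_plus1 le_add2)+
  have dom: "dom P = {(Suc i, Suc j) |i j. j < part mu (Suc i)}"
  proof (rule Set.set_eqI)
    fix x :: "nat \<times> nat"
    obtain i j where "x = (i, j)" by (cases x)
    then show "x \<in> dom P \<longleftrightarrow> x \<in> {(Suc i, Suc j) |i j. j < part mu (Suc i)}"
      using mu by (cases i; cases j) (auto simp: plane_overpartition_def diagram_def)
  qed
  have "antimono (\<lambda>i. part mu (Suc i))"
    using mu shape_of_partition[of mu] by (simp add: plane_overpartition_def shapes_def)
  then show ?thesis by (rule that[OF dom bounds])
qed

lemma overpartitions_betweenD:
  assumes "P \<in> overpartitions_between lam"
  shows "(i, j) \<in> dom P \<Longrightarrow> 0 < entry P i j"
    "(i, j) \<in> dom P \<Longrightarrow> (i, k) \<in> dom P \<Longrightarrow> j < k \<Longrightarrow> entry P i k \<le> entry P i j"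
    "(i, j) \<in> dom P \<Longrightarrow> (k, j) \<in> dom P \<Longrightarrow> i < k \<Longrightarrow> entry P k j \<le> entry P i j"
    "(i, j) \<in> dom P \<Longrightarrow> (i, k) \<in> dom P \<Longrightarrow> j < k \<Longrightarrow> entry P i j = entry P i k \<Longrightarrow> \<not> overlined P i j"
    "(i, j) \<in> dom P \<Longrightarrow> (k, j) \<in> dom P \<Longrightarrow> i < k \<Longrightarrow> entry P i j = entry P k j \<Longrightarrow> overlined P k j"
proof -
  obtain mu where "plane_overpartition mu P"
    using assms unfolding overpartitions_between_def by blast
  note c0 = this[unfolded plane_overpartition_def, THEN conjunct2, THEN conjunct2]
  note 1 = c0[THEN conjunct1] and c1 = c0[THEN conjunct2]
  note 2 = c1[THEN conjunct1] and c2 = c1[THEN conjunct2]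
  note 3 = c2[THEN conjunct1] and c3 = c2[THEN conjunct2]
  note 4 = c3[THEN conjunct1] and 5 = c3[THEN conjunct2]
  show "(i, j) \<in> dom P \<Longrightarrow> 0 < entry P i j" using 1 by blast
  show "(i, j) \<in> dom P \<Longrightarrow> (i, k) \<in> dom P \<Longrightarrow> j < k \<Longrightarrow> entry P i k \<le> entry P i j"
    using 2 by blast
  show "(i, j) \<in> dom P \<Longrightarrow> (k, j) \<in> dom P \<Longrightarrow> i < k \<Longrightarrow> entry P k j \<le> entry P i j"
    using 3 by blast
  show "(i, j) \<in> dom P \<Longrightarrow> (i, k) \<in> dom P \<Longrightarrow> j < k \<Longrightarrow> entry P i j = entry P i k \<Longrightarrow> \<not> overlined P i j"
    using 4 by blast
  show "(i, j) \<in> dom P \<Longrightarrow> (k, j) \<in> dom P \<Longrightarrow> i < k \<Longrightarrow> entry P i j = entry P k j \<Longrightarrow> overlined P k j"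
    using 5 by blast
qed

lemma tableau_of_filling_dom:
  "(Suc i, Suc j) \<in> dom P \<Longrightarrow>
    tableau_of_filling P i j = 2 * entry P (Suc i) (Suc j) - of_bool (overlined P (Suc i) (Suc j))"
  "(Suc i, Suc j) \<notin> dom P \<Longrightarrow> tableau_of_filling P i j = 0"
  by (auto simp: tableau_of_filling_def entry_def overlined_def split: option.split)

lemma tableau_of_filling_mem:
  assumes P: "P \<in> overpartitions_between lam" and lam: "is_partition lam"
  shows "tableau_of_filling P \<in> tableaux 0 (\<lambda>i. part lam (Suc i))"
proof -
  define r where "r i = part lam (Suc i)" for i
  have r: "antimono r" using shape_of_partition[OF lam] by (simp add: shapes_def r_def[abs_def])
  obtain m where dom: "dom P = {(Suc i, Suc j) |i j. j < m i}"
    and m: "\<And>i. m i \<le> r i" "\<And>i. r (Suc i) \<le> m i" "antimono m"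
    by (rule overpartitions_between_dom[OF P, folded r_def]) (rule that)
  have dom: "(Suc i, Suc j) \<in> dom P \<longleftrightarrow> j < m i" for i j by (simp add: dom)
  let ?T = "tableau_of_filling P"
  let ?e = "\<lambda>i j. entry P (Suc i) (Suc j)"
  let ?o = "\<lambda>i j. overlined P (Suc i) (Suc j)"
  have T: "?T i j = (if j < m i then 2 * ?e i j - of_bool (?o i j) else 0)" for i j
    using tableau_of_filling_dom[of i j P] by (simp add: dom)
  have pos: "0 < ?e i j" if "j < m i" for i j
    using overpartitions_betweenD(1)[OF P, of "Suc i" "Suc j"] that by (simp add: dom)
  have "?T \<in> tableaux 0 r"
  proof (rule tableauxI)
    show "?T i j = 0" if "r i \<le> j" for i j using m(1)[of i] that by (simp add: T)
    fix i j k :: nat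
    {
      assume "j < k"
      show "?T i k \<le> ?T i j"
        using overpartitions_betweenD(2,4)[OF P, of "Suc i" "Suc j" "Suc k"] \<open>j < k\<close> pos[of j i]
        by (cases "?e i j = ?e i k") (auto simp: T dom)
      assume "odd (?T i j + 0)"
      then show "?T i k < ?T i j"
        using overpartitions_betweenD(2,4)[OF P, of "Suc i" "Suc j" "Suc k"] \<open>j < k\<close> pos[of j i] pos[of k i]
        by (cases "?e i j = ?e i k"; cases "k < m i") (auto simp: T dom split: if_splits)
    }
    {
      assume "i < k" "j < r k"
      moreover have "r k \<le> r (Suc i)" using r \<open>i < k\<close> by (simp add: antimono_def)
      \<comment> \<open>A cell of \<open>lam\<close> with another one below it is filled, so no
        column contains two of the padding zeros.\<close>
      ultimately have ij: "j < m i" using m(2)[of i] by linarith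
      show "?T k j \<le> ?T i j"
        using overpartitions_betweenD(3,5)[OF P, of "Suc i" "Suc j" "Suc k"] \<open>i < k\<close> ij pos[of j i]
        by (cases "?e i j = ?e k j") (auto simp: T dom)
      assume "even (?T i j + 0)"
      then show "?T k j < ?T i j"
        using overpartitions_betweenD(3,5)[OF P, of "Suc i" "Suc j" "Suc k"] \<open>i < k\<close> ij pos[of j i] pos[of j k]
        by (cases "?e i j = ?e k j"; cases "j < m k") (auto simp: T dom split: if_splits)
    }
  qed
  then show ?thesis by (simp add: r_def[abs_def])
qed

lemma filling_of_tableau_of_filling:
  assumes P: "P \<in> overpartitions_between lam"
  shows "filling_of_tableau (tableau_of_filling P) = P"
proof (rule ext)
  fix x :: "nat \<times> nat"
  obtain i j where x: "x = (i, j)" by (cases x)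
  obtain m where dom: "dom P = {(Suc i, Suc j) |i j. j < m i}"
    by (rule overpartitions_between_dom[OF P]) (rule that)
  show "filling_of_tableau (tableau_of_filling P) x = P x"
  proof (cases "x \<in> dom P")
    case False
    then have "P x = None" by auto
    then show ?thesis
      using x by (cases i; cases j) (auto simp: filling_of_tableau_def tableau_of_filling_def)
  next
    case True
    then obtain i' j' where ij: "i = Suc i'" "j = Suc j'" using dom x by auto
    obtain n b where nb: "P x = Some (n, b)" using True by auto
    have "0 < n" using overpartitions_betweenD(1)[OF P, of i j] True nb x by (simp add: entry_def)
    then show ?thesis
      using nb x ij by (cases n; cases b) (auto simp: filling_of_tableau_def tableau_of_filling_def)
  qed
qed

lemma filling_of_tableau_mem:
  assumes T: "T \<in> tableaux 0 (\<lambda>i. part lam (Suc i))" and lam: "is_partition lam"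
  shows "filling_of_tableau T \<in> overpartitions_between lam"
proof -
  define r where "r i = part lam (Suc i)" for i
  have r: "r \<in> shapes (length lam)" using shape_of_partition[OF lam] by (simp add: r_def[abs_def])
  then have anti: "antimono r" by (simp add: shapes_def)
  have T: "T \<in> tableaux 0 r" using T by (simp add: r_def[abs_def])
  define m where "m = support_rows T"
  have m: "m \<in> strips 0 r" unfolding m_def by (rule support_rows_strips[OF anti T])
  have pos: "0 < T i j \<longleftrightarrow> j < m i" for i j unfolding m_def using less_support_rows_iff[OF T] by simp
  have less: "j < r i" if "0 < T i j" for i j
    using tableauxD(1)[OF T, of i j] that by (cases "j < r i") auto
  obtain mu where mu: "is_partition mu" "\<And>i. part mu (Suc i) = m i"
    using partition_of_shape[OF strips_shapes[OF r m]] by metis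
  let ?P = "filling_of_tableau T"
  have dom: "(i, j) \<in> dom ?P \<longleftrightarrow> 1 \<le> i \<and> 1 \<le> j \<and> 0 < T (i - 1) (j - 1)" for i j
    by (simp add: filling_of_tableau_def dom_def)
  have entry: "entry ?P i j = (T (i - 1) (j - 1) + 1) div 2"
    and overlined: "overlined ?P i j \<longleftrightarrow> odd (T (i - 1) (j - 1))" if "(i, j) \<in> dom ?P" for i j
    using that unfolding dom by (simp_all add: entry_def overlined_def filling_of_tableau_def)
  \<comment> \<open>Distinct codes of the same integer are \<open>2 * n - 1\<close> and
    \<open>2 * n\<close>.\<close>
  have half: "(t + 1) div 2 = (s + 1) div 2 \<Longrightarrow> t < s \<Longrightarrow> odd t \<and> even s" for s t :: nat
    by presburger
  have "plane_overpartition mu ?P"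
    unfolding plane_overpartition_def
  proof (intro conjI allI impI)
    show "dom ?P = diagram mu"
    proof (rule Set.set_eqI)
      fix x :: "nat \<times> nat"
      obtain i j where "x = (i, j)" by (cases x)
      then show "x \<in> dom ?P \<longleftrightarrow> x \<in> diagram mu"
        using mu(2)[of "i - 1"] pos[of "i - 1" "j - 1"]
        by (cases i; cases j) (auto simp: dom diagram_def)
    qed
    have "0 < entry ?P i j" if "(i, j) \<in> dom ?P" for i j
      using that unfolding entry[OF that] dom by simp
    then show "\<forall>(i, j)\<in>dom ?P. 0 < entry ?P i j" by blast
    fix i j k
    {
      assume *: "(i, j) \<in> dom ?P \<and> (i, k) \<in> dom ?P \<and> j < k"
      then have "j - 1 < k - 1" "k - 1 < r (i - 1)" using less by (auto simp: dom)
      note row = tableauxD(2,3)[OF T this]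
      show "entry ?P i k \<le> entry ?P i j" using * row(1) by (simp add: entry div_le_mono)
    }
    {
      assume *: "(i, j) \<in> dom ?P \<and> (k, j) \<in> dom ?P \<and> i < k"
      then have "i - 1 < k - 1" "j - 1 < r (k - 1)" using less by (auto simp: dom)
      note col = tableauxD(4,5)[OF T this]
      show "entry ?P k j \<le> entry ?P i j" using * col(1) by (simp add: entry div_le_mono)
    }
    {
      assume *: "(i, j) \<in> dom ?P \<and> (i, k) \<in> dom ?P \<and> j < k \<and> entry ?P i j = entry ?P i k"
      then have "j - 1 < k - 1" "k - 1 < r (i - 1)" using less by (auto simp: dom)
      note row = tableauxD(2,3)[OF T this]
      have eq: "(T (i - 1) (k - 1) + 1) div 2 = (T (i - 1) (j - 1) + 1) div 2"
        using * entry[of i j] entry[of i k] by metis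
      then have "even (T (i - 1) (j - 1))"
        using row(2) half[OF eq] by auto
      then show "\<not> overlined ?P i j" using overlined[of i j] * by blast
    }
    {
      assume *: "(i, j) \<in> dom ?P \<and> (k, j) \<in> dom ?P \<and> i < k \<and> entry ?P i j = entry ?P k j"
      then have "i - 1 < k - 1" "j - 1 < r (k - 1)" using less by (auto simp: dom)
      note col = tableauxD(4,5)[OF T this]
      have eq: "(T (k - 1) (j - 1) + 1) div 2 = (T (i - 1) (j - 1) + 1) div 2"
        using * entry[of i j] entry[of k j] by metis
      have "odd (T (k - 1) (j - 1))"
      proof (cases "T (k - 1) (j - 1) < T (i - 1) (j - 1)")
        case True
        then show ?thesis using half[OF eq] by simp
      next
        case False
        then have "T (k - 1) (j - 1) = T (i - 1) (j - 1)" using col(1) by linarith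
        then show ?thesis using col(2) by auto
      qed
      then show "overlined ?P k j" using overlined[of k j] * by blast
    }
  qed (rule mu)
  moreover have "part lam (i + 1) \<le> part mu i \<and> part mu i \<le> part lam i" if "1 \<le> i" for i
  proof -
    obtain k where "i = Suc k" using \<open>1 \<le> i\<close> by (cases i) auto
    then show ?thesis using m mu(2)[of k] by (simp add: strips_def r_def)
  qed
  ultimately show ?thesis unfolding overpartitions_between_def by blast
qed

lemma bij_betw_tableau_of_filling:
  assumes "is_partition lam"
  shows "bij_betw tableau_of_filling (overpartitions_between lam) (tableaux 0 (\<lambda>i. part lam (Suc i)))"
proof (rule bij_betw_byWitness[where f' = filling_of_tableau])
  show "\<forall>P\<in>overpartitions_between lam. filling_of_tableau (tableau_of_filling P) = P"
    using filling_of_tableau_of_filling by blast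
  show "\<forall>T\<in>tableaux 0 (\<lambda>i. part lam (Suc i)). tableau_of_filling (filling_of_tableau T) = T"
    using tableau_of_filling_of_tableau by blast
  show "tableau_of_filling ` overpartitions_between lam \<subseteq> tableaux 0 (\<lambda>i. part lam (Suc i))"
    using tableau_of_filling_mem[OF _ assms] by blast
  show "filling_of_tableau ` tableaux 0 (\<lambda>i. part lam (Suc i)) \<subseteq> overpartitions_between lam"
    using filling_of_tableau_mem[OF _ assms] by blast
qed

section \<open>Transfer of weights, contents and hooks\<close>

lemma dom_subset:
  assumes "P \<in> overpartitions_between lam"
  shows "dom P \<subseteq> map_prod Suc Suc ` Sigma {..<length lam} (\<lambda>i. {..<part lam (Suc i)})"
proof
  fix x assume "x \<in> dom P"
  obtain m where dom: "dom P = {(Suc i, Suc j) |i j. j < m i}" and m: "\<And>i. m i \<le> part lam (Suc i)"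
    by (rule overpartitions_between_dom[OF assms]) (rule that)
  then obtain i j where x: "x = (Suc i, Suc j)" "j < m i" using \<open>x \<in> dom P\<close> by auto
  then have "j < part lam (Suc i)" using m[of i] by linarith
  moreover from this have "i < length lam" by (cases "i < length lam") (auto simp: part_def)
  ultimately show "x \<in> map_prod Suc Suc ` Sigma {..<length lam} (\<lambda>i. {..<part lam (Suc i)})"
    using x by (auto intro!: image_eqI[of _ _ "(i, j)"])
qed

text \<open>The cells of \<open>lam\<close> that the filling leaves empty are coded by 0 and
  contribute \<open>g 0 = 0\<close>.\<close>

lemma sum_over_dom:
  fixes g :: "nat \<Rightarrow> nat"
  assumes P: "P \<in> overpartitions_between lam" and "g 0 = 0"
  shows "(\<Sum>i<length lam. \<Sum>j<part lam (Suc i). g (tableau_of_filling P i j)) =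
    (\<Sum>(i, j)\<in>dom P. g (tableau_of_filling P (i - 1) (j - 1)))"
proof -
  let ?S = "Sigma {..<length lam} (\<lambda>i. {..<part lam (Suc i)})"
  let ?f = "\<lambda>(i, j). g (tableau_of_filling P (i - 1) (j - 1))"
  have "(\<Sum>i<length lam. \<Sum>j<part lam (Suc i). g (tableau_of_filling P i j)) =
      (\<Sum>x\<in>?S. ?f (map_prod Suc Suc x))"
    by (simp add: sum.Sigma case_prod_unfold)
  also have "\<dots> = sum ?f (map_prod Suc Suc ` ?S)"
    by (subst sum.reindex) (auto intro: inj_onI)
  also have "\<dots> = sum ?f (dom P)"
  proof (rule sum.mono_neutral_right)
    show "dom P \<subseteq> map_prod Suc Suc ` ?S" by (rule dom_subset[OF P])
    show "\<forall>x\<in>map_prod Suc Suc ` ?S - dom P. ?f x = 0"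
    proof
      fix x assume x: "x \<in> map_prod Suc Suc ` ?S - dom P"
      then obtain i j where ij: "x = (Suc i, Suc j)" by auto
      then have "tableau_of_filling P i j = 0" using tableau_of_filling_dom(2) x by blast
      then show "?f x = 0" using ij \<open>g 0 = 0\<close> by simp
    qed
  qed auto
  finally show ?thesis .
qed

lemma weight_eq_sum:
  assumes P: "P \<in> overpartitions_between lam"
  shows "weight P = (\<Sum>i<length lam. \<Sum>j<part lam (Suc i). (tableau_of_filling P i j + 1) div 2)"
    and "num_overlined P = (\<Sum>i<length lam. \<Sum>j<part lam (Suc i). tableau_of_filling P i j mod 2)"
proof -
  obtain m where dom: "dom P = {(Suc i, Suc j) |i j. j < m i}"
    by (rule overpartitions_between_dom[OF P]) (rule that)
  have T: "tableau_of_filling P (i - 1) (j - 1) = 2 * entry P i j - of_bool (overlined P i j)"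
    "0 < entry P i j" if "(i, j) \<in> dom P" for i j
    using that tableau_of_filling_dom(1)[of "i - 1" "j - 1" P] overpartitions_betweenD(1)[OF P] dom by auto
  have T2: "(tableau_of_filling P (i - 1) (j - 1) + 1) div 2 = entry P i j"
    "tableau_of_filling P (i - 1) (j - 1) mod 2 = of_bool (overlined P i j)" if "(i, j) \<in> dom P" for i j
    using T[OF that] by (cases "entry P i j"; auto)+
  have "weight P = (\<Sum>(i, j)\<in>dom P. (tableau_of_filling P (i - 1) (j - 1) + 1) div 2)"
    unfolding weight_def
  proof (intro sum.cong refl)
    fix x assume "x \<in> dom P"
    then show "(case x of (i, j) \<Rightarrow> entry P i j) =
        (case x of (i, j) \<Rightarrow> (tableau_of_filling P (i - 1) (j - 1) + 1) div 2)"
      using T2(1)[of "fst x" "snd x"] by (simp add: case_prod_unfold)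
  qed
  then show "weight P = (\<Sum>i<length lam. \<Sum>j<part lam (Suc i). (tableau_of_filling P i j + 1) div 2)"
    using sum_over_dom[OF P, of "\<lambda>t. (t + 1) div 2"] by simp
  have "finite (dom P)"
    by (rule finite_subset[OF dom_subset[OF P]]) auto
  then have "num_overlined P = (\<Sum>(i, j)\<in>dom P. of_bool (overlined P i j))"
    unfolding num_overlined_def case_prod_unfold
    by (simp add: Int_def)
  also have "\<dots> = (\<Sum>(i, j)\<in>dom P. tableau_of_filling P (i - 1) (j - 1) mod 2)"
  proof (intro sum.cong refl)
    fix x assume "x \<in> dom P"
    then show "(case x of (i, j) \<Rightarrow> of_bool (overlined P i j)) =
        (case x of (i, j) \<Rightarrow> tableau_of_filling P (i - 1) (j - 1) mod 2)"
      using T2(2)[of "fst x" "snd x"] by (simp add: case_prod_unfold)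
  qed
  finally show "num_overlined P = (\<Sum>i<length lam. \<Sum>j<part lam (Suc i). tableau_of_filling P i j mod 2)"
    using sum_over_dom[OF P, of "\<lambda>t. t mod 2"] by simp
qed

lemma diagram_eq_image:
  "diagram lam = map_prod Suc Suc ` Sigma {..<length lam} (\<lambda>i. {..<part lam (Suc i)})"
proof (rule Set.set_eqI)
  fix x :: "nat \<times> nat"
  obtain i j where "x = (i, j)" by (cases x)
  moreover have "k < length lam" if "t < part lam (Suc k)" for k t
    using that by (cases "k < length lam") (auto simp: part_def)
  ultimately show "x \<in> diagram lam \<longleftrightarrow> x \<in> map_prod Suc Suc ` Sigma {..<length lam} (\<lambda>i. {..<part lam (Suc i)})"
    by (cases i; cases j) (auto simp: diagram_def image_iff Suc_le_eq)
qed

lemma prod_diagram: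
  "(\<Prod>(i, j)\<in>diagram lam. g i j) = (\<Prod>i<length lam. \<Prod>j<part lam (Suc i). g (Suc i) (Suc j))"
proof -
  let ?S = "Sigma {..<length lam} (\<lambda>i. {..<part lam (Suc i)})"
  have "(\<Prod>i<length lam. \<Prod>j<part lam (Suc i). g (Suc i) (Suc j)) =
      (\<Prod>x\<in>?S. (\<lambda>(i, j). g i j) (map_prod Suc Suc x))"
    by (simp add: prod.Sigma case_prod_unfold)
  also have "\<dots> = (\<Prod>(i, j)\<in>map_prod Suc Suc ` ?S. g i j)"
    by (subst prod.reindex) (auto intro: inj_onI)
  finally show ?thesis by (simp add: diagram_eq_image)
qed

lemma hook_length_eq_hook:
  assumes lam: "is_partition lam" and t: "t < part lam (Suc i)"
  shows "hook_length lam (Suc i) (Suc t) = int (hook (\<lambda>i. part lam (Suc i)) i t)"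
proof -
  define r where "r i = part lam (Suc i)" for i
  have r: "r \<in> shapes (length lam)" using shape_of_partition[OF lam] by (simp add: r_def[abs_def])
  have "{k. (k, Suc t) \<in> diagram lam} = Suc ` {k. t < r k}"
  proof (rule Set.set_eqI)
    fix k
    show "k \<in> {k. (k, Suc t) \<in> diagram lam} \<longleftrightarrow> k \<in> Suc ` {k. t < r k}"
      by (cases k) (auto simp: diagram_def r_def)
  qed
  then have card: "card {k. (k, Suc t) \<in> diagram lam} = card {k. t < r k}"
    by (simp add: card_image)
  \<comment> \<open>This makes \<open>Suc t\<close> a genuine index of the conjugate, whose length
    is the first part, and rules out the default value 0 of \<open>part\<close>.\<close>
  have "t < r 0" using t shapesD(1)[OF r, of 0 i] by (simp add: r_def)
  then have "part (Defs.conjugate lam) (Suc t) = card {k. t < r k}"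
    using card by (simp add: part_def conjugate_def r_def del: upt_Suc)
  moreover have "i < card {k. t < r k}" using less_column_iff[OF r] t by (simp add: r_def)
  ultimately show ?thesis
    using t by (simp add: hook_length_def hook_def r_def[abs_def])
qed

section \<open>The generating function of the overpartitions\<close>

theorem theorem4:
  fixes lam :: "nat list" and a :: "'k::field"
  defines "A \<equiv> fls_const a" and "q \<equiv> (fls_X :: 'k fls)"
  assumes "is_partition lam"
  shows "((\<lambda>P. A ^ num_overlined P * q ^ weight P) has_sum
            (q ^ (\<Sum>i = 1..length lam. (i - 1) * part lam i) *
             (\<Prod>(i, j)\<in>diagram lam.
                (1 + A * q powi (cell_content i j + 1)) / (1 - q powi hook_length lam i j))))
          (overpartitions_between lam)"
proof -
  interpret overpartition_series a .
  define l where "l = length lam"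
  define r where "r i = part lam (Suc i)" for i
  have r: "r \<in> shapes l"
    using shape_of_partition[OF assms(3)] by (simp add: r_def[abs_def] l_def)
  have pos: "0 < r i" if "i < l" for i
    using assms(3) that by (simp add: is_partition_def r_def l_def part_def)
  have "(tableau_weight l 0 r has_sum jacobi_trudi l r) (tableaux 0 r)"
    by (rule has_sum_tableau_weight[OF r])
  moreover have "bij_betw tableau_of_filling (overpartitions_between lam) (tableaux 0 r)"
    using bij_betw_tableau_of_filling[OF assms(3)] by (simp add: r_def[abs_def])
  ultimately have "((\<lambda>P. tableau_weight l 0 r (tableau_of_filling P)) has_sum jacobi_trudi l r)
      (overpartitions_between lam)"
    using has_sum_reindex_bij_betw by blast
  moreover have "tableau_weight l 0 r (tableau_of_filling P) = A ^ num_overlined P * q ^ weight P"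
    if "P \<in> overpartitions_between lam" for P
    unfolding tableau_weight_altdef weight_eq_sum[OF that] A_def q_def by (simp add: r_def l_def)
  ultimately have "((\<lambda>P. A ^ num_overlined P * q ^ weight P) has_sum jacobi_trudi l r)
      (overpartitions_between lam)"
    using has_sum_cong by force
  also have "jacobi_trudi l r = q ^ (\<Sum>i = 1..length lam. (i - 1) * part lam i) *
      (\<Prod>(i, j)\<in>diagram lam.
        (1 + A * q powi (cell_content i j + 1)) / (1 - q powi hook_length lam i j))"
  proof -
    have "(\<Sum>i<l. i * r i) = (\<Sum>i = 1..length lam. (i - 1) * part lam i)"
      by (rule sum.reindex_bij_witness[where i = "\<lambda>i. i - 1" and j = Suc]) (auto simp: r_def l_def)
    moreover have "(\<Prod>i<l. \<Prod>t<r i. (1 + A * q powi (int t - int i + 1)) / (1 - q ^ hook r i t)) =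
        (\<Prod>(i, j)\<in>diagram lam.
          (1 + A * q powi (cell_content i j + 1)) / (1 - q powi hook_length lam i j))"
      unfolding prod_diagram l_def r_def
      by (intro prod.cong refl) (simp add: hook_length_eq_hook[OF assms(3)] cell_content_def)
    moreover have "jacobi_trudi l r = q ^ (\<Sum>i<l. i * r i) *
        (\<Prod>i<l. \<Prod>t<r i. (1 + A * q powi (int t - int i + 1)) / (1 - q ^ hook r i t))"
      unfolding A_def q_def
      by (rule jacobi_trudi_hook_product[OF r pos one_plus_powi_nonzero]) auto
    ultimately show ?thesis by simp
  qed
  finally show ?thesis .
qed

end
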